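(* Let $X=[x_1,\dots,x_n]^T$ be a random vector in $\mathbb{R}^n$ with i.i.d. entries satisfying $\mathbb{E}x_1=0$, $\mathbb{E}x_1^2=1$, $\mathbb{E}x_1^4=1+\sigma^2$ with $0\le\sigma<\infty$. Let $S$ be an $m\times n$ random matrix (viewed as a map $\mathbb{R}^n\to\mathbb{R}^m$) with i.i.d. entries $S_{i,j}$ satisfying $\mathbb{E}S_{i,j}=0$, $\mathbb{E}S_{i,j}^2=1$ and $\mathbb{E}S_{1,1}^4<c<\infty$ for some constant $c$. Assume $S$ and $X$ are independent. Let $\xi=(\mathbb{E}S_{1,1}^4-1)\mathbb{E}x_1^4-2$ and define \[ A(m,n)=\frac{\|SX\|^2-mn}{\sqrt{\sigma^2m^2n+2mn^2+\xi mn}}. \] If $m,n\to\infty$ with $\frac{m}{n}\to 0$, then $A(m,n)$ converges in distribution to the standard normal distribution $\mathcal{N}(0,1)$.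
   Context: $\|\cdot\|$ denotes the Euclidean norm, so $\|SX\|^2=X^TS^TSX$. *)

theory Defs
  imports "HOL-Probability.Probability"
begin

definition sq_norm_SX :: "nat \<Rightarrow> nat \<Rightarrow> (nat \<Rightarrow> nat \<Rightarrow> real) \<Rightarrow> (nat \<Rightarrow> real) \<Rightarrow> real" where
  "sq_norm_SX m n S X = (\<Sum>i<m. (\<Sum>j<n. S i j * X j)\<^sup>2)"

end

theory Submission
  imports Defs
begin

text \<open>
  Write \<open>q\<close> for \<open>\<parallel>X\<parallel>\<^sup>2 / n\<close> and \<open>Y\<^sub>i\<close> for the \<open>i\<close>-th entry of \<open>SX\<close>. Then \<open>(\<parallel>SX\<parallel>\<^sup>2 - m n) / n\<close> is the sum of the
  \<open>Z\<^sub>i = Y\<^sub>i\<^sup>2 / n - q\<close> and of \<open>m (q - 1)\<close>; after normalisation the latter has variance of order \<open>m / n\<close>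
  and is negligible. Given \<open>X\<close>, the \<open>Z\<^sub>i\<close> are independent and centred with a variance that tends to \<open>2\<close>
  in mean, so the conditional characteristic function of their sum is a product which is compared
  factor by factor with \<open>exp (- s\<^sup>2)\<close>. The averaged Taylor remainder of a factor vanishes because the
  \<open>Z\<^sub>i\<^sup>2\<close> are uniformly integrable. Unconditionally \<open>Y\<^sub>i\<close> is a sum of \<open>n\<close> i.i.d. products \<open>S\<^sub>i\<^sub>j x\<^sub>j\<close> with
  finite fourth moment, so this follows from the classical central limit theorem together with
  \<open>E (Y\<^sub>i / sqrt n)\<^sup>4 \<longlonglongrightarrow> 3\<close>.
\<close>

section \<open>Moments of sums of independent random variables\<close>

lemma power_le_one_plus_power:
  fixes y :: real
  assumes "k \<le> n"
  shows "\<bar>y\<bar> ^ k \<le> 1 + \<bar>y\<bar> ^ n"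
proof (cases "\<bar>y\<bar> \<le> 1")
  case True
  then have "\<bar>y\<bar> ^ k \<le> 1" by (simp add: power_le_one)
  then show ?thesis by (simp add: add_increasing2)
next
  case False
  then have "\<bar>y\<bar> ^ k \<le> \<bar>y\<bar> ^ n" using assms by (intro power_increasing) auto
  then show ?thesis by simp
qed

lemma (in finite_measure) integrable_lower_power:
  fixes f :: "'a \<Rightarrow> real"
  assumes [measurable]: "f \<in> borel_measurable M" and "integrable M (\<lambda>\<omega>. f \<omega> ^ n)" and "k \<le> n"
  shows "integrable M (\<lambda>\<omega>. f \<omega> ^ k)"
proof (rule Bochner_Integration.integrable_bound)
  show "integrable M (\<lambda>\<omega>. 1 + norm (f \<omega> ^ n))"
    using assms(2) by simp
  show "AE \<omega> in M. norm (f \<omega> ^ k) \<le> norm (1 + norm (f \<omega> ^ n))"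
    using power_le_one_plus_power[OF \<open>k \<le> n\<close>] by (auto simp: power_abs)
qed simp

text \<open>Independence makes the joint law a product of the marginal laws, so Fubini applies; each
  marginal is then pulled back to \<open>M\<close>. The inner integral over a second sample point
  plays the role of the conditional expectation given \<open>X\<close>.\<close>

lemma (in prob_space) indep_var_integral_decouple:
  fixes F :: "'b \<times> 'b \<Rightarrow> 'd::{banach, second_countable_topology}"
  assumes indep: "indep_var N X L Y"
    and F [measurable]: "F \<in> borel_measurable (N \<Otimes>\<^sub>M L)"
    and int: "integrable M (\<lambda>\<omega>. F (X \<omega>, Y \<omega>))"
  shows "integrable M (\<lambda>\<omega>. \<integral>\<omega>'. F (X \<omega>, Y \<omega>') \<partial>M)"
    and "(\<integral>\<omega>. F (X \<omega>, Y \<omega>) \<partial>M) = (\<integral>\<omega>. (\<integral>\<omega>'. F (X \<omega>, Y \<omega>') \<partial>M) \<partial>M)"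
proof -
  have X [measurable]: "X \<in> measurable M N" and Y [measurable]: "Y \<in> measurable M L"
    and eq: "distr M N X \<Otimes>\<^sub>M distr M L Y = distr M (N \<Otimes>\<^sub>M L) (\<lambda>\<omega>. (X \<omega>, Y \<omega>))"
    using indep unfolding indep_var_distribution_eq by auto
  interpret DX: prob_space "distr M N X" by (rule prob_space_distr) simp
  interpret DY: prob_space "distr M L Y" by (rule prob_space_distr) simp
  interpret DP: pair_prob_space "distr M N X" "distr M L Y" ..
  have intP: "integrable (distr M N X \<Otimes>\<^sub>M distr M L Y) F"
    unfolding eq using int by (simp add: integrable_distr_eq)
  have inner: "(\<integral>y. F (u, y) \<partial>distr M L Y) = (\<integral>\<omega>'. F (u, Y \<omega>') \<partial>M)" if "u \<in> space N" for u
    using that by (intro integral_distr) simp_all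
  have sp: "X \<omega> \<in> space N" if "\<omega> \<in> space M" for \<omega>
    using measurable_space[OF X that] .
  have "integrable (distr M N X) (\<lambda>u. \<integral>y. F (u, y) \<partial>distr M L Y)"
    using DP.integrable_fst[of "\<lambda>u y. F (u, y)"] intP by simp
  then have "integrable M (\<lambda>\<omega>. \<integral>y. F (X \<omega>, y) \<partial>distr M L Y)"
    by (rule integrable_distr[OF X])
  then show "integrable M (\<lambda>\<omega>. \<integral>\<omega>'. F (X \<omega>, Y \<omega>') \<partial>M)"
    by (rule Bochner_Integration.integrable_cong[THEN iffD1, rotated -1]) (auto simp: inner sp)
  have "(\<integral>\<omega>. F (X \<omega>, Y \<omega>) \<partial>M) = (\<integral>p. F p \<partial>(distr M N X \<Otimes>\<^sub>M distr M L Y))"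
    unfolding eq by (subst integral_distr) simp_all
  also have "\<dots> = (\<integral>u. (\<integral>y. F (u, y) \<partial>distr M L Y) \<partial>distr M N X)"
    using DP.integral_fst[of "\<lambda>u y. F (u, y)"] intP by simp
  also have "\<dots> = (\<integral>\<omega>. (\<integral>y. F (X \<omega>, y) \<partial>distr M L Y) \<partial>M)"
    by (rule integral_distr) simp_all
  also have "\<dots> = (\<integral>\<omega>. (\<integral>\<omega>'. F (X \<omega>, Y \<omega>') \<partial>M) \<partial>M)"
    by (intro Bochner_Integration.integral_cong) (auto simp: inner sp)
  finally show "(\<integral>\<omega>. F (X \<omega>, Y \<omega>) \<partial>M) = (\<integral>\<omega>. (\<integral>\<omega>'. F (X \<omega>, Y \<omega>') \<partial>M) \<partial>M)" .
qed

lemma (in prob_space) indep_var_power_mult: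
  fixes U V :: "'a \<Rightarrow> real"
  assumes indep: "indep_var borel U borel V"
    and "integrable M (\<lambda>\<omega>. U \<omega> ^ k)" "integrable M (\<lambda>\<omega>. V \<omega> ^ l)"
  shows "integrable M (\<lambda>\<omega>. U \<omega> ^ k * V \<omega> ^ l)"
    and "expectation (\<lambda>\<omega>. U \<omega> ^ k * V \<omega> ^ l) = expectation (\<lambda>\<omega>. U \<omega> ^ k) * expectation (\<lambda>\<omega>. V \<omega> ^ l)"
proof -
  have "indep_var borel ((\<lambda>y. y ^ k) \<circ> U) borel ((\<lambda>y. y ^ l) \<circ> V)"
    by (rule indep_var_compose[OF indep]) simp_all
  then have "indep_var borel (\<lambda>\<omega>. U \<omega> ^ k) borel (\<lambda>\<omega>. V \<omega> ^ l)" by (simp add: comp_def)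
  with assms show "integrable M (\<lambda>\<omega>. U \<omega> ^ k * V \<omega> ^ l)"
    and "expectation (\<lambda>\<omega>. U \<omega> ^ k * V \<omega> ^ l) = expectation (\<lambda>\<omega>. U \<omega> ^ k) * expectation (\<lambda>\<omega>. V \<omega> ^ l)"
    by (auto intro: indep_var_integrable indep_var_lebesgue_integral)
qed

lemma (in prob_space) indep_sum_moments_2:
  fixes U :: "nat \<Rightarrow> 'a \<Rightarrow> real"
  assumes "indep_vars (\<lambda>_. borel) U {..<n}"
    and "\<And>j. j < n \<Longrightarrow> integrable M (\<lambda>\<omega>. (U j \<omega>)\<^sup>2)"
    and "\<And>j. j < n \<Longrightarrow> expectation (U j) = 0"
  shows "integrable M (\<lambda>\<omega>. (\<Sum>j<n. U j \<omega>)\<^sup>2)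
    \<and> expectation (\<lambda>\<omega>. \<Sum>j<n. U j \<omega>) = 0
    \<and> expectation (\<lambda>\<omega>. (\<Sum>j<n. U j \<omega>)\<^sup>2) = (\<Sum>j<n. expectation (\<lambda>\<omega>. (U j \<omega>)\<^sup>2))"
  using assms
proof (induction n)
  case 0
  then show ?case by simp
next
  case (Suc n)
  define A where "A = (\<lambda>\<omega>. \<Sum>j<n. U j \<omega>)"
  have IH: "integrable M (\<lambda>\<omega>. (A \<omega>)\<^sup>2)" "expectation A = 0"
     "expectation (\<lambda>\<omega>. (A \<omega>)\<^sup>2) = (\<Sum>j<n. expectation (\<lambda>\<omega>. (U j \<omega>)\<^sup>2))"
    using Suc.IH[OF indep_vars_subset[OF Suc.prems(1)]] Suc.prems(2,3)
    by (auto simp: A_def)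
  have "indep_var borel (U n) borel (\<lambda>\<omega>. \<Sum>i<n. U i \<omega>)"
    using Suc.prems(1) by (intro indep_vars_sum) (auto simp: lessThan_Suc)
  then have ind: "indep_var borel (U n) borel A" by (simp add: A_def)
  have mU [measurable]: "U n \<in> borel_measurable M" and mA [measurable]: "A \<in> borel_measurable M"
    using indep_var_rv1[OF ind] indep_var_rv2[OF ind] .
  have iU: "integrable M (\<lambda>\<omega>. (U n \<omega>)\<^sup>2)" using Suc.prems(2) by simp
  have iA1: "integrable M A" and iU1: "integrable M (U n)"
    using integrable_lower_power[OF mA IH(1), of 1] integrable_lower_power[OF mU iU, of 1] by simp_all
  note mixed = indep_var_power_mult[OF ind, of 1 1, simplified, OF iU1 iA1]
  have eq: "(\<Sum>j<Suc n. U j \<omega>) = A \<omega> + U n \<omega>" for \<omega> by (simp add: A_def)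
  have e2: "(A \<omega> + U n \<omega>)\<^sup>2 = (A \<omega>)\<^sup>2 + 2 * (U n \<omega> * A \<omega>) + (U n \<omega>)\<^sup>2" for \<omega>
    by (simp add: power2_sum)
  have "integrable M (\<lambda>\<omega>. (A \<omega> + U n \<omega>)\<^sup>2)"
    unfolding e2 by (intro Bochner_Integration.integrable_add integrable_mult_right IH(1) iU mixed(1))
  moreover have "expectation (\<lambda>\<omega>. A \<omega> + U n \<omega>) = 0"
    using iA1 iU1 IH(2) Suc.prems(3)[of n] by simp
  moreover have "expectation (\<lambda>\<omega>. (A \<omega> + U n \<omega>)\<^sup>2)
      = expectation (\<lambda>\<omega>. (A \<omega>)\<^sup>2) + expectation (\<lambda>\<omega>. (U n \<omega>)\<^sup>2)"
    unfolding e2 using mixed IH(1,2) iU by simp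
  ultimately show ?case
    unfolding eq unfolding sum.lessThan_Suc by (simp add: IH)
qed

text \<open>For a centred variable, fourth moment minus three times the squared variance is the
  fourth cumulant, and cumulants add over independent summands. The induction verifies this
  additivity.\<close>

lemma (in prob_space) indep_sum_moments_4:
  fixes U :: "nat \<Rightarrow> 'a \<Rightarrow> real"
  assumes "indep_vars (\<lambda>_. borel) U {..<n}"
    and "\<And>j. j < n \<Longrightarrow> integrable M (\<lambda>\<omega>. U j \<omega> ^ 4)"
    and "\<And>j. j < n \<Longrightarrow> expectation (U j) = 0"
  shows "integrable M (\<lambda>\<omega>. (\<Sum>j<n. U j \<omega>) ^ 4)
    \<and> expectation (\<lambda>\<omega>. (\<Sum>j<n. U j \<omega>) ^ 4) = 3 * (\<Sum>j<n. expectation (\<lambda>\<omega>. (U j \<omega>)\<^sup>2))\<^sup>2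
        + (\<Sum>j<n. expectation (\<lambda>\<omega>. U j \<omega> ^ 4) - 3 * (expectation (\<lambda>\<omega>. (U j \<omega>)\<^sup>2))\<^sup>2)"
  using assms
proof (induction n)
  case 0
  then show ?case by simp
next
  case (Suc n)
  define A where "A = (\<lambda>\<omega>. \<Sum>j<n. U j \<omega>)"
  have mU [measurable]: "U j \<in> borel_measurable M" if "j \<le> n" for j
    using Suc.prems(1) that unfolding indep_vars_def by auto
  have iU: "integrable M (\<lambda>\<omega>. U j \<omega> ^ k)" if "k \<le> 4" "j \<le> n" for k j
    using that by (intro integrable_lower_power[OF mU Suc.prems(2)]) auto
  note indn = indep_vars_subset[OF Suc.prems(1), of "{..<n}"]
  have IH: "integrable M (\<lambda>\<omega>. A \<omega> ^ 4)"
     "expectation (\<lambda>\<omega>. A \<omega> ^ 4) = 3 * (\<Sum>j<n. expectation (\<lambda>\<omega>. (U j \<omega>)\<^sup>2))\<^sup>2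
        + (\<Sum>j<n. expectation (\<lambda>\<omega>. U j \<omega> ^ 4) - 3 * (expectation (\<lambda>\<omega>. (U j \<omega>)\<^sup>2))\<^sup>2)"
    using Suc.IH[OF indn] Suc.prems(2,3) by (auto simp: A_def)
  have low: "expectation A = 0"
     "expectation (\<lambda>\<omega>. (A \<omega>)\<^sup>2) = (\<Sum>j<n. expectation (\<lambda>\<omega>. (U j \<omega>)\<^sup>2))"
    using indep_sum_moments_2[OF indn] iU[of 2] Suc.prems(3) by (auto simp: A_def)
  have "indep_var borel (U n) borel (\<lambda>\<omega>. \<Sum>i<n. U i \<omega>)"
    using Suc.prems(1) by (intro indep_vars_sum) (auto simp: lessThan_Suc)
  then have ind: "indep_var borel (U n) borel A" by (simp add: A_def)
  have iA: "integrable M (\<lambda>\<omega>. A \<omega> ^ k)" if "k \<le> 4" for k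
    using integrable_lower_power[OF indep_var_rv2[OF ind] IH(1) that] .
  note mixed = indep_var_power_mult[OF ind iU iA]
  have eq: "(\<Sum>j<Suc n. U j \<omega>) = A \<omega> + U n \<omega>" for \<omega> by (simp add: A_def)
  have e4: "(A \<omega> + U n \<omega>) ^ 4 = A \<omega> ^ 4 + 4 * (U n \<omega> ^ 1 * A \<omega> ^ 3) + 6 * (U n \<omega> ^ 2 * A \<omega> ^ 2)
       + 4 * (U n \<omega> ^ 3 * A \<omega> ^ 1) + U n \<omega> ^ 4" for \<omega>
    by (simp add: power_numeral_reduce algebra_simps)
  have "integrable M (\<lambda>\<omega>. (A \<omega> + U n \<omega>) ^ 4)"
    unfolding e4 by (intro Bochner_Integration.integrable_add integrable_mult_right iA iU mixed(1)) simp_all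
  \<comment> \<open>The mixed terms with exponents 1 and 3 vanish because both means do; only the
    one with two squares survives.\<close>
  moreover have "expectation (\<lambda>\<omega>. (A \<omega> + U n \<omega>) ^ 4)
      = expectation (\<lambda>\<omega>. A \<omega> ^ 4) + 6 * (expectation (\<lambda>\<omega>. (U n \<omega>)\<^sup>2) * expectation (\<lambda>\<omega>. (A \<omega>)\<^sup>2))
        + expectation (\<lambda>\<omega>. U n \<omega> ^ 4)"
    unfolding e4
    using mixed[of 1 3] mixed[of 2 2] mixed[of 3 1] iA[of 4] iU[of 4] low(1) Suc.prems(3)[of n] by simp
  ultimately show ?case
    unfolding eq unfolding sum.lessThan_Suc
    by (simp add: IH low power2_sum[of "expectation (\<lambda>\<omega>. (U n \<omega>)\<^sup>2)"] algebra_simps)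
qed

section \<open>Uniform integrability of fourth powers\<close>

lemma std_normal_truncated_fourth_moment_tendsto:
  "(\<lambda>K::nat. \<integral>y. min (y ^ 4) (real K ^ 4 / 2) \<partial>std_normal_distribution) \<longlonglongrightarrow> 3"
proof -
  have mom: "(\<integral>y. y ^ 4 \<partial>std_normal_distribution) = 3" "integrable std_normal_distribution (\<lambda>y. y ^ 4)"
    using std_normal_distribution_even_moments[of 2] by (simp_all add: fact_numeral)
  have "(\<lambda>K::nat. \<integral>y. min (y ^ 4) (real K ^ 4 / 2) \<partial>std_normal_distribution) \<longlonglongrightarrow> (\<integral>y. y ^ 4 \<partial>std_normal_distribution)"
  proof (rule integral_dominated_convergence[where w = "\<lambda>y. y ^ 4"])
    show "AE y in std_normal_distribution. (\<lambda>K::nat. min (y ^ 4) (real K ^ 4 / 2)) \<longlonglongrightarrow> y ^ 4"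
    proof (rule AE_I2)
      fix y :: real
      have "filterlim (\<lambda>K::nat. real K ^ 4 / 2) at_top sequentially"
        by real_asymp
      then have "\<forall>\<^sub>F K in sequentially. y ^ 4 \<le> real K ^ 4 / 2"
        by (simp add: filterlim_at_top)
      then have "\<forall>\<^sub>F K in sequentially. min (y ^ 4) (real K ^ 4 / 2) = y ^ 4"
        by eventually_elim simp
      then show "(\<lambda>K::nat. min (y ^ 4) (real K ^ 4 / 2)) \<longlonglongrightarrow> y ^ 4"
        by (rule tendsto_eventually)
    qed
  qed (use mom in \<open>auto\<close>)
  then show ?thesis by (simp add: mom)
qed

text \<open>Up to level \<open>K\<close> the sixth power is at most \<open>K ^ 6\<close>. Beyond it,
  capping at \<open>K ^ 4 / 2\<close> removes at least half of \<open>g ^ 4\<close>, so twice the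
  loss dominates. The cap, unlike an indicator of a large value, is continuous in \<open>g\<close>,
  as weak convergence requires.\<close>

lemma min_fourth_sixth_le_truncation:
  fixes g s :: real and K :: nat
  shows "min (g ^ 4) (\<bar>s\<bar> * g ^ 6) \<le> \<bar>s\<bar> * real K ^ 6 + 2 * (g ^ 4 - min (g ^ 4) (real K ^ 4 / 2))"
proof (cases "\<bar>g\<bar> \<le> real K")
  case True
  have "\<bar>g\<bar> ^ 6 \<le> real K ^ 6" using True by (intro power_mono) auto
  then have "\<bar>s\<bar> * g ^ 6 \<le> \<bar>s\<bar> * real K ^ 6"
    by (intro mult_left_mono) (auto simp: power_even_abs)
  moreover have "min (g ^ 4) (real K ^ 4 / 2) \<le> g ^ 4" "min (g ^ 4) (\<bar>s\<bar> * g ^ 6) \<le> \<bar>s\<bar> * g ^ 6"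
    by simp_all
  ultimately show ?thesis by argo
next
  case False
  then have "real K ^ 4 \<le> \<bar>g\<bar> ^ 4" by (intro power_mono) auto
  then have "real K ^ 4 \<le> g ^ 4" by (simp add: power_even_abs)
  moreover have "0 \<le> \<bar>s\<bar> * real K ^ 6" "min (g ^ 4) (real K ^ 4 / 2) \<le> real K ^ 4 / 2"
      "min (g ^ 4) (\<bar>s\<bar> * g ^ 6) \<le> g ^ 4"
    by simp_all
  ultimately show ?thesis by argo
qed

text \<open>The central limit theorem together with the convergence of fourth moments makes the fourth
  powers of the normalised sums uniformly integrable. The smaller of the second and third order
  bounds of the Taylor remainder turns uniform integrability into this limit.\<close>

lemma (in prob_space) iid_sum_fourth_power_uniformly_integrable:
  fixes W :: "nat \<Rightarrow> 'a \<Rightarrow> real" and n :: "nat \<Rightarrow> nat" and s :: "nat \<Rightarrow> real"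
  defines "G \<equiv> \<lambda>k \<omega>. (\<Sum>j<n k. W j \<omega>) / sqrt (real (n k))"
  assumes indep: "indep_vars (\<lambda>_. borel) W UNIV"
    and int4: "integrable M (\<lambda>\<omega>. W 0 \<omega> ^ 4)"
    and mean: "expectation (W 0) = 0"
    and var: "expectation (\<lambda>\<omega>. (W 0 \<omega>)\<^sup>2) = 1"
    and ident: "\<And>j. distr M borel (W j) = distr M borel (W 0)"
    and n: "filterlim n at_top sequentially"
    and s: "s \<longlonglongrightarrow> 0"
  shows "(\<lambda>k. expectation (\<lambda>\<omega>. min (G k \<omega> ^ 4) (\<bar>s k\<bar> * G k \<omega> ^ 6))) \<longlonglongrightarrow> 0"
proof -
  have W [measurable]: "W j \<in> borel_measurable M" for j
    using indep unfolding indep_vars_def by auto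
  have transfer: "expectation (\<lambda>\<omega>. f (W j \<omega>)) = expectation (\<lambda>\<omega>. f (W 0 \<omega>))"
    if [measurable]: "f \<in> borel_measurable borel" for f :: "real \<Rightarrow> real" and j
    using integral_distr[OF W that, of j] integral_distr[OF W that, of 0] ident[of j] by simp
  have int4': "integrable M (\<lambda>\<omega>. W j \<omega> ^ 4)" for j
    using int4 integrable_distr_eq[OF W, of "\<lambda>y. y ^ 4" j] integrable_distr_eq[OF W, of "\<lambda>y. y ^ 4" 0] ident[of j]
    by simp
  define \<kappa> where "\<kappa> = expectation (\<lambda>\<omega>. W 0 \<omega> ^ 4)"
  have m1: "expectation (W j) = 0" for j using transfer[of "\<lambda>y. y" j] mean by simp
  have m2: "expectation (\<lambda>\<omega>. (W j \<omega>)\<^sup>2) = 1" for j using transfer[of "\<lambda>y. y\<^sup>2" j] var by simp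
  have m4: "expectation (\<lambda>\<omega>. W j \<omega> ^ 4) = \<kappa>" for j using transfer[of "\<lambda>y. y ^ 4" j] by (simp add: \<kappa>_def)
  have G [measurable]: "G k \<in> borel_measurable M" for k unfolding G_def by measurable
  note sums = indep_sum_moments_4[OF indep_vars_subset[OF indep] int4' m1, simplified]
  have G4: "integrable M (\<lambda>\<omega>. G k \<omega> ^ 4)" for k
    using sums[of "n k"] unfolding G_def by (simp add: power_divide)
  have EG4: "expectation (\<lambda>\<omega>. G k \<omega> ^ 4) = 3 + (\<kappa> - 3) / real (n k)" if "n k > 0" for k
  proof -
    have sq: "sqrt (real (n k)) ^ 4 = (real (n k))\<^sup>2"
      by (metis mult_2 numeral_Bit0 of_nat_0_le_iff power2_eq_square power_add real_sqrt_pow2)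
    have "expectation (\<lambda>\<omega>. G k \<omega> ^ 4) = expectation (\<lambda>\<omega>. (\<Sum>j<n k. W j \<omega>) ^ 4) / (real (n k))\<^sup>2"
      unfolding G_def by (simp add: power_divide sq)
    also have "\<dots> = (3 * (real (n k))\<^sup>2 + real (n k) * (\<kappa> - 3)) / (real (n k))\<^sup>2"
      using sums[of "n k"] by (simp add: m2 m4)
    also have "\<dots> = 3 + (\<kappa> - 3) / real (n k)"
      using that by (simp add: field_simps power2_eq_square)
    finally show ?thesis .
  qed
  have nr: "filterlim (\<lambda>k. real (n k)) at_top sequentially"
    using filterlim_compose[OF filterlim_real_sequentially n] .
  have npos: "\<forall>\<^sub>F k in sequentially. n k > 0"
    using eventually_compose_filterlim[OF eventually_gt_at_top n] .
  have "(\<lambda>k. 3 + (\<kappa> - 3) / real (n k)) \<longlonglongrightarrow> 3 + 0"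
    by (intro tendsto_intros tendsto_divide_0[OF tendsto_const] filterlim_at_top_imp_at_infinity nr)
  moreover have "\<forall>\<^sub>F k in sequentially. 3 + (\<kappa> - 3) / real (n k) = expectation (\<lambda>\<omega>. G k \<omega> ^ 4)"
    using npos by eventually_elim (simp add: EG4)
  ultimately have lim4: "(\<lambda>k. expectation (\<lambda>\<omega>. G k \<omega> ^ 4)) \<longlonglongrightarrow> 3"
    using Lim_transform_eventually by force
  \<comment> \<open>The redundant square matches the central limit theorem, which is stated for a
    variance given as the square of a standard deviation.\<close>
  have var': "variance (W j) = 1\<^sup>2" for j using m1 m2 by simp
  have sq_int: "integrable M (\<lambda>\<omega>. (W j \<omega>)\<^sup>2)" for j
    by (rule integrable_lower_power[OF W int4']) simp
  have clt: "weak_conv_m (\<lambda>l. distr M borel (\<lambda>\<omega>. (\<Sum>j<l. W j \<omega>) / sqrt (real l * 1\<^sup>2))) std_normal_distribution"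
    by (rule central_limit_theorem_zero_mean[OF indep m1 _ sq_int var' ident]) simp
  have limtr: "(\<lambda>k. expectation (\<lambda>\<omega>. min (G k \<omega> ^ 4) (real K ^ 4 / 2)))
      \<longlonglongrightarrow> (\<integral>y. min (y ^ 4) (real K ^ 4 / 2) \<partial>std_normal_distribution)" for K :: nat
  proof -
    have "(\<lambda>l. \<integral>y. min (y ^ 4) (real K ^ 4 / 2) \<partial>distr M borel (\<lambda>\<omega>. (\<Sum>j<l. W j \<omega>) / sqrt (real l * 1\<^sup>2)))
      \<longlonglongrightarrow> (\<integral>y. min (y ^ 4) (real K ^ 4 / 2) \<partial>std_normal_distribution)"
      by (rule weak_conv_imp_integral_bdd_continuous_conv[OF _ real_dist_normal_dist clt, where B = "real K ^ 4 / 2"])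
         (auto intro!: continuous_intros)
    from filterlim_compose[OF this n] show ?thesis
      by (simp add: integral_distr G_def)
  qed
  show ?thesis
  proof (rule tendstoI)
    fix e :: real assume e: "e > 0"
    \<comment> \<open>The truncation level is fixed first, so that the Gaussian fourth-moment loss
      is below \<open>e / 2\<close>; only then does \<open>k\<close> grow.\<close>
    have "(\<lambda>K::nat. 2 * (3 - (\<integral>y. min (y ^ 4) (real K ^ 4 / 2) \<partial>std_normal_distribution))) \<longlonglongrightarrow> 2 * (3 - 3)"
      by (intro tendsto_intros std_normal_truncated_fourth_moment_tendsto)
    then have "\<forall>\<^sub>F K::nat in sequentially. 2 * (3 - (\<integral>y. min (y ^ 4) (real K ^ 4 / 2) \<partial>std_normal_distribution)) < e"
      by (rule order_tendstoD) (use e in simp)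
    then obtain K :: nat where K: "2 * (3 - (\<integral>y. min (y ^ 4) (real K ^ 4 / 2) \<partial>std_normal_distribution)) < e"
      using eventually_happens'[OF sequentially_bot] by blast
    \<comment> \<open>For fixed \<open>K\<close> the first summand vanishes with \<open>s k\<close>.
      In the second, the full fourth moment tends to 3 and the truncated one to its Gaussian value,
      so the limit is the quantity just made smaller than \<open>e\<close>.\<close>
    define b where "b k = \<bar>s k\<bar> * real K ^ 6
       + 2 * (expectation (\<lambda>\<omega>. G k \<omega> ^ 4) - expectation (\<lambda>\<omega>. min (G k \<omega> ^ 4) (real K ^ 4 / 2)))" for k
    have "b \<longlonglongrightarrow> \<bar>0\<bar> * real K ^ 6 + 2 * (3 - (\<integral>y. min (y ^ 4) (real K ^ 4 / 2) \<partial>std_normal_distribution))"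
      unfolding b_def by (intro tendsto_intros s lim4 limtr)
    then have "\<forall>\<^sub>F k in sequentially. b k < e"
      by (rule order_tendstoD) (use K in simp)
    moreover have "expectation (\<lambda>\<omega>. min (G k \<omega> ^ 4) (\<bar>s k\<bar> * G k \<omega> ^ 6)) \<le> b k" for k
    proof -
      have i1: "integrable M (\<lambda>\<omega>. min (G k \<omega> ^ 4) (real K ^ 4 / 2))"
        by (rule Bochner_Integration.integrable_bound[OF G4[of k]]) auto
      have i2: "integrable M (\<lambda>\<omega>. min (G k \<omega> ^ 4) (\<bar>s k\<bar> * G k \<omega> ^ 6))"
        by (rule Bochner_Integration.integrable_bound[OF G4[of k]]) auto
      have "expectation (\<lambda>\<omega>. min (G k \<omega> ^ 4) (\<bar>s k\<bar> * G k \<omega> ^ 6))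
          \<le> expectation (\<lambda>\<omega>. \<bar>s k\<bar> * real K ^ 6 + 2 * (G k \<omega> ^ 4 - min (G k \<omega> ^ 4) (real K ^ 4 / 2)))"
        using i1 i2 G4[of k] by (intro integral_mono min_fourth_sixth_le_truncation) auto
      also have "\<dots> = b k" using i1 G4[of k] by (simp add: b_def prob_space)
      finally show ?thesis .
    qed
    moreover have "0 \<le> expectation (\<lambda>\<omega>. min (G k \<omega> ^ 4) (\<bar>s k\<bar> * G k \<omega> ^ 6))" for k
      by (intro integral_nonneg_AE) auto
    ultimately show "\<forall>\<^sub>F k in sequentially. dist (expectation (\<lambda>\<omega>. min (G k \<omega> ^ 4) (\<bar>s k\<bar> * G k \<omega> ^ 6))) 0 < e"
      by (auto elim!: eventually_mono intro: le_less_trans)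
  qed
qed

section \<open>Conditional characteristic function given the vector\<close>

definition mean_square :: "nat \<Rightarrow> (nat \<Rightarrow> real) \<Rightarrow> real" where
  "mean_square n a = (\<Sum>j<n. (a j)\<^sup>2) / real n"

text \<open>This is the \<open>Z\<close> of the overview with the vector frozen at \<open>a\<close>
  and the matrix row at \<open>b\<close>.\<close>

definition row_excess :: "nat \<Rightarrow> (nat \<Rightarrow> real) \<Rightarrow> (nat \<Rightarrow> real) \<Rightarrow> real" where
  "row_excess n a b = (\<Sum>j<n. b j * a j)\<^sup>2 / real n - mean_square n a"

text \<open>For a random row of i.i.d. centred entries with unit variance and fourth moment
  \<open>\<kappa>\<close>, this is the variance of \<open>row_excess\<close> at a fixed vector
  \<open>a\<close>; see \<open>row_excess_moments\<close>.\<close>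

definition row_variance :: "nat \<Rightarrow> real \<Rightarrow> (nat \<Rightarrow> real) \<Rightarrow> real" where
  "row_variance n \<kappa> a = 2 * (mean_square n a)\<^sup>2 + (\<kappa> - 3) * (\<Sum>j<n. a j ^ 4) / (real n)\<^sup>2"

section \<open>Elementary inequalities for the Taylor comparison\<close>

lemma abs_exp_minus_linear_le:
  fixes u :: real
  assumes "u \<ge> 0"
  shows "\<bar>1 - u - exp (- u)\<bar> \<le> u\<^sup>2"
proof -
  have "1 - u \<le> exp (- u)" using exp_ge_add_one_self[of "- u"] by simp
  moreover have "exp (- u) \<le> 1 / (1 + u)"
    using exp_ge_add_one_self[of u] assms by (simp add: exp_minus field_simps)
  moreover have "1 / (1 + u) \<le> 1 - u + u\<^sup>2"
    using assms by (simp add: field_simps power2_eq_square)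
  ultimately show ?thesis by linarith
qed

text \<open>The left side is the Taylor remainder of a row excess, with \<open>g\<close> the
  normalised row sum. If \<open>g\<^sup>2\<close> is at least \<open>q\<close>, the deviation is at
  most \<open>g\<^sup>2\<close>. Otherwise it is at most \<open>q\<close>: for \<open>q\<close> up
  to 2 its cube is at most 8, and for larger \<open>q\<close> it is at most
  \<open>2 * (q - 1)\<close>, whose square times 6 gives the constant 24.\<close>

lemma min_square_cube_diff_le:
  fixes g q s :: real
  assumes "q \<ge> 0"
  shows "min (6 * (g\<^sup>2 - q)\<^sup>2) (\<bar>s\<bar> * \<bar>g\<^sup>2 - q\<bar> ^ 3)
    \<le> 6 * min (g ^ 4) (\<bar>s\<bar> * g ^ 6) + 8 * \<bar>s\<bar> + 24 * (q - 1)\<^sup>2"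
proof -
  define z where "z = \<bar>g\<^sup>2 - q\<bar>"
  have z0: "z \<ge> 0" and zsq: "(g\<^sup>2 - q)\<^sup>2 = z\<^sup>2" by (simp_all add: z_def)
  have nn: "0 \<le> min (g ^ 4) (\<bar>s\<bar> * g ^ 6)" by simp
  have "min (6 * z\<^sup>2) (\<bar>s\<bar> * z ^ 3) \<le> 6 * min (g ^ 4) (\<bar>s\<bar> * g ^ 6) + 8 * \<bar>s\<bar> + 24 * (q - 1)\<^sup>2"
  proof (cases "q \<le> g\<^sup>2")
    case True
    then have zg: "z \<le> g\<^sup>2" using assms by (simp add: z_def)
    have "z\<^sup>2 \<le> (g\<^sup>2)\<^sup>2" "z ^ 3 \<le> (g\<^sup>2) ^ 3" by (rule power_mono[OF zg z0])+
    then have "z\<^sup>2 \<le> g ^ 4" "\<bar>s\<bar> * z ^ 3 \<le> \<bar>s\<bar> * g ^ 6" by (simp_all add: mult_left_mono flip: power_mult)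
    moreover have "0 \<le> \<bar>s\<bar> * g ^ 6" by simp
    ultimately have "min (6 * z\<^sup>2) (\<bar>s\<bar> * z ^ 3) \<le> 6 * g ^ 4"
        "min (6 * z\<^sup>2) (\<bar>s\<bar> * z ^ 3) \<le> 6 * (\<bar>s\<bar> * g ^ 6)"
      using min.cobounded1[of "6 * z\<^sup>2" "\<bar>s\<bar> * z ^ 3"] min.cobounded2[of "6 * z\<^sup>2" "\<bar>s\<bar> * z ^ 3"]
      by linarith+
    then have "min (6 * z\<^sup>2) (\<bar>s\<bar> * z ^ 3) \<le> 6 * min (g ^ 4) (\<bar>s\<bar> * g ^ 6)"
      by (cases "g ^ 4 \<le> \<bar>s\<bar> * g ^ 6") (simp_all only: min_absorb1 min_absorb2 linorder_not_le less_imp_le)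
    then show ?thesis by (simp add: add_increasing2)
  next
    case False
    then have zq: "z \<le> q" by (simp add: z_def)
    show ?thesis
    proof (cases "q \<le> 2")
      case True
      then have "z ^ 3 \<le> 2 ^ 3" using zq z0 by (intro power_mono) auto
      then have "\<bar>s\<bar> * z ^ 3 \<le> 8 * \<bar>s\<bar>" using mult_left_mono[of "z ^ 3" 8 "\<bar>s\<bar>"] by simp
      then have "min (6 * z\<^sup>2) (\<bar>s\<bar> * z ^ 3) \<le> 8 * \<bar>s\<bar>" by simp
      moreover have "0 \<le> 24 * (q - 1)\<^sup>2" by simp
      ultimately show ?thesis using nn by linarith
    next
      case False
      have "z\<^sup>2 \<le> (2 * (q - 1))\<^sup>2" using zq z0 False by (intro power_mono) auto
      then have "6 * z\<^sup>2 \<le> 24 * (q - 1)\<^sup>2" by (simp only: power_mult_distrib) simp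
      then have "min (6 * z\<^sup>2) (\<bar>s\<bar> * z ^ 3) \<le> 24 * (q - 1)\<^sup>2" by simp
      then show ?thesis using nn by linarith
    qed
  qed
  then show ?thesis unfolding zsq z_def[symmetric] .
qed

lemma abs_le_weighted_square:
  fixes y d :: real
  assumes "d > 0"
  shows "\<bar>y\<bar> \<le> (d + y\<^sup>2 / d) / 2"
proof -
  have "0 \<le> (\<bar>y\<bar> - d)\<^sup>2" by simp
  then show ?thesis using assms by (simp add: field_simps power2_eq_square)
qed

text \<open>A single independent family over the sum type expresses at once that the vector entries
  are independent, that the matrix entries are independent, and that vector and matrix are
  independent of each other. One infinite array serves all dimensions; the sketch of size
  \<open>m\<close> by \<open>n\<close> is its upper left corner.\<close>

locale iid_sketch = prob_space M for M :: "'a measure" +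
  fixes x :: "nat \<Rightarrow> 'a \<Rightarrow> real" and S :: "nat \<Rightarrow> nat \<Rightarrow> 'a \<Rightarrow> real" and \<sigma> :: real
  assumes x_meas [measurable]: "x j \<in> borel_measurable M"
    and S_meas [measurable]: "S i j \<in> borel_measurable M"
    and indep: "indep_vars (\<lambda>_. borel) (\<lambda>k. case k of Inl j \<Rightarrow> x j | Inr (i, j) \<Rightarrow> S i j) UNIV"
    and x_ident: "distr M borel (x j) = distr M borel (x 0)"
    and S_ident: "distr M borel (S i j) = distr M borel (S 0 0)"
    and x_int4: "integrable M (\<lambda>\<omega>. x 0 \<omega> ^ 4)"
    and x_mean: "expectation (x 0) = 0"
    and x_var: "expectation (\<lambda>\<omega>. (x 0 \<omega>)\<^sup>2) = 1"
    and x_4th: "expectation (\<lambda>\<omega>. x 0 \<omega> ^ 4) = 1 + \<sigma>\<^sup>2"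
    and S_int4: "integrable M (\<lambda>\<omega>. S 0 0 \<omega> ^ 4)"
    and S_mean: "expectation (S 0 0) = 0"
    and S_var: "expectation (\<lambda>\<omega>. (S 0 0 \<omega>)\<^sup>2) = 1"
begin

definition \<kappa> :: real where "\<kappa> = expectation (\<lambda>\<omega>. S 0 0 \<omega> ^ 4)"

abbreviation entry :: "nat + nat \<times> nat \<Rightarrow> 'a \<Rightarrow> real" where
  "entry \<equiv> \<lambda>k. case k of Inl j \<Rightarrow> x j | Inr (i, j) \<Rightarrow> S i j"

abbreviation excess :: "nat \<Rightarrow> nat \<Rightarrow> 'a \<Rightarrow> real" where
  "excess n i \<omega> \<equiv> row_excess n (\<lambda>j. x j \<omega>) (\<lambda>j. S i j \<omega>)"

text \<open>Independence of two random variables requires them to have the same type, so the vector and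
  the matrix both live on the joint index type, restricted to one summand each.\<close>

abbreviation vector_space :: "(nat + nat \<times> nat \<Rightarrow> real) measure" where
  "vector_space \<equiv> PiM (range Inl) (\<lambda>_. borel)"

abbreviation matrix_space :: "(nat + nat \<times> nat \<Rightarrow> real) measure" where
  "matrix_space \<equiv> PiM (range Inr) (\<lambda>_. borel)"

section \<open>Moments of the entries and independence of blocks\<close>

lemma entry_transfer:
  fixes f :: "real \<Rightarrow> real"
  assumes [measurable]: "f \<in> borel_measurable borel"
  shows "expectation (\<lambda>\<omega>. f (x j \<omega>)) = expectation (\<lambda>\<omega>. f (x 0 \<omega>))"
    and "expectation (\<lambda>\<omega>. f (S i j \<omega>)) = expectation (\<lambda>\<omega>. f (S 0 0 \<omega>))"
    and "integrable M (\<lambda>\<omega>. f (x j \<omega>)) \<longleftrightarrow> integrable M (\<lambda>\<omega>. f (x 0 \<omega>))"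
    and "integrable M (\<lambda>\<omega>. f (S i j \<omega>)) \<longleftrightarrow> integrable M (\<lambda>\<omega>. f (S 0 0 \<omega>))"
  by (simp_all add: x_ident[of j] S_ident[of i j]
      flip: integral_distr[OF x_meas assms] integral_distr[OF S_meas assms]
        integrable_distr_eq[OF x_meas assms] integrable_distr_eq[OF S_meas assms])

lemma entry_moments:
  shows "expectation (x j) = 0" "expectation (\<lambda>\<omega>. (x j \<omega>)\<^sup>2) = 1" "expectation (\<lambda>\<omega>. x j \<omega> ^ 4) = 1 + \<sigma>\<^sup>2"
    "expectation (S i j) = 0" "expectation (\<lambda>\<omega>. (S i j \<omega>)\<^sup>2) = 1" "expectation (\<lambda>\<omega>. S i j \<omega> ^ 4) = \<kappa>"
  using entry_transfer(1)[of "\<lambda>y. y" j] entry_transfer(1)[of "\<lambda>y. y ^ 2" j] entry_transfer(1)[of "\<lambda>y. y ^ 4" j]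
    entry_transfer(2)[of "\<lambda>y. y" i j] entry_transfer(2)[of "\<lambda>y. y ^ 2" i j] entry_transfer(2)[of "\<lambda>y. y ^ 4" i j]
    x_mean x_var x_4th S_mean S_var by (simp_all add: \<kappa>_def)

lemma entry_integrable:
  assumes "k \<le> 4"
  shows "integrable M (\<lambda>\<omega>. x j \<omega> ^ k)" "integrable M (\<lambda>\<omega>. S i j \<omega> ^ k)"
  using entry_transfer(3)[of "\<lambda>y. y ^ 4" j] entry_transfer(4)[of "\<lambda>y. y ^ 4" i j] x_int4 S_int4 assms
  by (auto intro!: integrable_lower_power[where n = 4])

text \<open>Functions of disjoint groups of independent entries are independent. The groups used
  below are single matrix entries, whole matrix rows, single vector entries, and pairs of a vector
  entry with a matrix entry in its column.\<close>

lemma indep_vars_blocks: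
  assumes "disjoint_family_on K L"
    and "\<And>l. l \<in> L \<Longrightarrow> f l \<in> measurable (PiM (K l) (\<lambda>_. borel)) borel"
  shows "indep_vars (\<lambda>_. borel) (\<lambda>l \<omega>. f l (restrict (\<lambda>k. entry k \<omega>) (K l))) L"
  by (rule indep_vars_compose2[OF indep_vars_restrict[OF indep _ assms(1)]]) (use assms(2) in auto)

text \<open>Stands in for conditioning on the vector: the inner integral averages over the matrix
  while the vector stays fixed. \<open>F\<close> acts on plain sequences, and its measurability is
  tested through the coordinates of the two product spaces.\<close>

lemma decouple:
  fixes F :: "(nat \<Rightarrow> real) \<Rightarrow> (nat \<Rightarrow> nat \<Rightarrow> real) \<Rightarrow> 'd::{banach, second_countable_topology}"
  assumes F: "(\<lambda>p. F (\<lambda>j. fst p (Inl j)) (\<lambda>i j. snd p (Inr (i, j))))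
      \<in> borel_measurable (vector_space \<Otimes>\<^sub>M matrix_space)"
    and int: "integrable M (\<lambda>\<omega>. F (\<lambda>j. x j \<omega>) (\<lambda>i j. S i j \<omega>))"
  shows "integrable M (\<lambda>\<omega>. \<integral>\<omega>'. F (\<lambda>j. x j \<omega>) (\<lambda>i j. S i j \<omega>') \<partial>M)"
    and "(\<integral>\<omega>. F (\<lambda>j. x j \<omega>) (\<lambda>i j. S i j \<omega>) \<partial>M)
      = (\<integral>\<omega>. (\<integral>\<omega>'. F (\<lambda>j. x j \<omega>) (\<lambda>i j. S i j \<omega>') \<partial>M) \<partial>M)"
proof -
  have ind: "indep_var vector_space (\<lambda>\<omega>. restrict (\<lambda>k. entry k \<omega>) (range Inl))
      matrix_space (\<lambda>\<omega>. restrict (\<lambda>k. entry k \<omega>) (range Inr))"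
    by (rule indep_var_restrict[OF indep]) auto
  show "integrable M (\<lambda>\<omega>. \<integral>\<omega>'. F (\<lambda>j. x j \<omega>) (\<lambda>i j. S i j \<omega>') \<partial>M)"
    and "(\<integral>\<omega>. F (\<lambda>j. x j \<omega>) (\<lambda>i j. S i j \<omega>) \<partial>M)
      = (\<integral>\<omega>. (\<integral>\<omega>'. F (\<lambda>j. x j \<omega>) (\<lambda>i j. S i j \<omega>') \<partial>M) \<partial>M)"
    using indep_var_integral_decouple[OF ind F] int by simp_all
qed

section \<open>Conditional moments of one row\<close>

lemma row_moments:
  fixes a :: "nat \<Rightarrow> real"
  shows "integrable M (\<lambda>\<omega>. (\<Sum>j<n. S i j \<omega> * a j) ^ 4)"
    and "expectation (\<lambda>\<omega>. (\<Sum>j<n. S i j \<omega> * a j)\<^sup>2) = (\<Sum>j<n. (a j)\<^sup>2)"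
    and "expectation (\<lambda>\<omega>. (\<Sum>j<n. S i j \<omega> * a j) ^ 4) = 3 * (\<Sum>j<n. (a j)\<^sup>2)\<^sup>2 + (\<kappa> - 3) * (\<Sum>j<n. a j ^ 4)"
proof -
  have "indep_vars (\<lambda>_. borel)
      (\<lambda>j \<omega>. (\<lambda>f. f (Inr (i, j)) * a j) (restrict (\<lambda>k. entry k \<omega>) {Inr (i, j)})) {..<n}"
    by (rule indep_vars_blocks) (auto simp: disjoint_family_on_def)
  then have ind: "indep_vars (\<lambda>_. borel) (\<lambda>j \<omega>. S i j \<omega> * a j) {..<n}" by simp
  have "integrable M (\<lambda>\<omega>. (S i j \<omega> * a j) ^ k)" if "k \<le> 4" for j k
    using entry_integrable(2)[OF that] by (simp add: power_mult_distrib)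
  note int = this[of 2, simplified] this[of 4, simplified]
  have m1: "expectation (\<lambda>\<omega>. S i j \<omega> * a j) = 0" for j by (simp add: entry_moments)
  have m2: "expectation (\<lambda>\<omega>. (S i j \<omega> * a j)\<^sup>2) = (a j)\<^sup>2" for j
    by (simp add: entry_moments power_mult_distrib)
  have m4: "expectation (\<lambda>\<omega>. (S i j \<omega> * a j) ^ 4) = \<kappa> * a j ^ 4" for j
    by (simp add: entry_moments power_mult_distrib)
  have sq: "((a j)\<^sup>2)\<^sup>2 = a j ^ 4" for j by simp
  show "integrable M (\<lambda>\<omega>. (\<Sum>j<n. S i j \<omega> * a j) ^ 4)"
    and "expectation (\<lambda>\<omega>. (\<Sum>j<n. S i j \<omega> * a j)\<^sup>2) = (\<Sum>j<n. (a j)\<^sup>2)"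
    and "expectation (\<lambda>\<omega>. (\<Sum>j<n. S i j \<omega> * a j) ^ 4) = 3 * (\<Sum>j<n. (a j)\<^sup>2)\<^sup>2 + (\<kappa> - 3) * (\<Sum>j<n. a j ^ 4)"
    using indep_sum_moments_2[OF ind int(1) m1] indep_sum_moments_4[OF ind int(2) m1]
    by (simp_all add: m2 m4 sq sum_distrib_left left_diff_distrib sum_subtractf)
qed

lemma row_excess_moments:
  fixes a :: "nat \<Rightarrow> real" and i :: nat
  assumes "n > 0"
  defines "Z \<equiv> \<lambda>\<omega>. row_excess n a (\<lambda>j. S i j \<omega>)"
  shows "integrable M Z" "integrable M (\<lambda>\<omega>. (Z \<omega>)\<^sup>2)" "expectation Z = 0"
    "expectation (\<lambda>\<omega>. (Z \<omega>)\<^sup>2) = row_variance n \<kappa> a"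
proof -
  define R where "R = (\<lambda>\<omega>. \<Sum>j<n. S i j \<omega> * a j)"
  define r where "r = (\<Sum>j<n. (a j)\<^sup>2)"
  have [measurable]: "R \<in> borel_measurable M" unfolding R_def by measurable
  have R4: "integrable M (\<lambda>\<omega>. R \<omega> ^ 4)" and ER2: "expectation (\<lambda>\<omega>. (R \<omega>)\<^sup>2) = r"
    and ER4: "expectation (\<lambda>\<omega>. R \<omega> ^ 4) = 3 * r\<^sup>2 + (\<kappa> - 3) * (\<Sum>j<n. a j ^ 4)"
    using row_moments[where n = n and i = i and a = a] by (simp_all add: R_def r_def)
  have R2: "integrable M (\<lambda>\<omega>. (R \<omega>)\<^sup>2)" by (rule integrable_lower_power[OF _ R4]) simp_all
  have Z: "Z = (\<lambda>\<omega>. ((R \<omega>)\<^sup>2 - r) / real n)"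
    by (simp add: Z_def row_excess_def mean_square_def R_def r_def diff_divide_distrib)
  have Z2: "(Z \<omega>)\<^sup>2 = (R \<omega> ^ 4 - 2 * r * (R \<omega>)\<^sup>2 + r\<^sup>2) / (real n)\<^sup>2" for \<omega>
    by (simp add: Z power_divide power2_diff algebra_simps flip: power_mult)
  show "integrable M Z" using R2 by (simp add: Z)
  show "integrable M (\<lambda>\<omega>. (Z \<omega>)\<^sup>2)" using R2 R4 by (simp add: Z2)
  show "expectation Z = 0" using R2 ER2 by (simp add: Z prob_space)
  \<comment> \<open>The multiples of \<open>r\<^sup>2\<close> add up to
    \<open>3 - 2 + 1 = 2\<close>, the leading coefficient of \<open>row_variance\<close> and the
    source of the limiting variance 2.\<close>
  have "expectation (\<lambda>\<omega>. (Z \<omega>)\<^sup>2) = (3 * r\<^sup>2 + (\<kappa> - 3) * (\<Sum>j<n. a j ^ 4) - 2 * r * r + r\<^sup>2) / (real n)\<^sup>2"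
    unfolding Z2 using R2 R4 ER2 ER4 by (simp add: prob_space)
  also have "\<dots> = row_variance n \<kappa> a"
    by (simp add: row_variance_def mean_square_def r_def power_divide power2_eq_square add_divide_distrib)
  finally show "expectation (\<lambda>\<omega>. (Z \<omega>)\<^sup>2) = row_variance n \<kappa> a" .
qed

text \<open>Times \<open>s\<^sup>2 / 6\<close>, this bounds the error of the second-order expansion
  of a characteristic function. The cube gives smallness as \<open>s\<close> tends to 0. The square
  keeps the minimum integrable: a cubed excess involves sixth powers of the entries, of which only
  fourth moments are assumed finite.\<close>

definition remainder :: "nat \<Rightarrow> real \<Rightarrow> (nat \<Rightarrow> real) \<Rightarrow> nat \<Rightarrow> real" where
  "remainder n s a i = expectation (\<lambda>\<omega>. min (6 * (row_excess n a (\<lambda>j. S i j \<omega>))\<^sup>2)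
      (\<bar>s\<bar> * \<bar>row_excess n a (\<lambda>j. S i j \<omega>)\<bar> ^ 3))"

text \<open>Three replacements, one error term each: the characteristic function by its quadratic
  Taylor polynomial, the variance in that polynomial by 2, and the resulting
  \<open>1 - s\<^sup>2\<close> by the exponential.\<close>

lemma row_char_approx:
  fixes a :: "nat \<Rightarrow> real"
  assumes n: "n > 0"
  shows "cmod (expectation (\<lambda>\<omega>. iexp (s * row_excess n a (\<lambda>j. S i j \<omega>))) - exp (- (s\<^sup>2)))
    \<le> s\<^sup>2 / 6 * remainder n s a i + s\<^sup>2 / 2 * \<bar>row_variance n \<kappa> a - 2\<bar> + s ^ 4"
proof -
  define Z where "Z \<omega> = row_excess n a (\<lambda>j. S i j \<omega>)" for \<omega>
  define v where "v = row_variance n \<kappa> a"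
  note mom = row_excess_moments[OF n, where a = a and i = i, folded Z_def v_def]
  have [measurable]: "Z \<in> borel_measurable M" unfolding Z_def row_excess_def by measurable
  have "cmod (char (distr M borel Z) s - (1 - s\<^sup>2 * v / 2)) \<le> s\<^sup>2 / 6 * remainder n s a i"
    unfolding remainder_def Z_def[symmetric] by (rule char_approx3') (use mom in auto)
  moreover have "char (distr M borel Z) s = expectation (\<lambda>\<omega>. iexp (s * Z \<omega>))"
    by (simp add: char_def integral_distr)
  moreover have "cmod (complex_of_real (1 - s\<^sup>2 * v / 2 - exp (- (s\<^sup>2)))) \<le> s\<^sup>2 / 2 * \<bar>v - 2\<bar> + s ^ 4"
  proof -
    have "1 - s\<^sup>2 * v / 2 - exp (- (s\<^sup>2)) = s\<^sup>2 / 2 * (2 - v) + (1 - s\<^sup>2 - exp (- (s\<^sup>2)))"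
      by (simp add: field_simps)
    then have "\<bar>1 - s\<^sup>2 * v / 2 - exp (- (s\<^sup>2))\<bar> \<le> \<bar>s\<^sup>2 / 2 * (2 - v)\<bar> + \<bar>1 - s\<^sup>2 - exp (- (s\<^sup>2))\<bar>"
      by linarith
    also have "\<dots> \<le> s\<^sup>2 / 2 * \<bar>v - 2\<bar> + s ^ 4"
      using abs_exp_minus_linear_le[of "s\<^sup>2"] by (simp add: abs_mult abs_minus_commute)
    finally show ?thesis by (simp only: norm_of_real)
  qed
  ultimately show ?thesis
    unfolding Z_def[symmetric] v_def[symmetric]
    using norm_triangle_ineq[of "char (distr M borel Z) s - (1 - s\<^sup>2 * v / 2)" "complex_of_real (1 - s\<^sup>2 * v / 2 - exp (- (s\<^sup>2)))"]
    by simp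
qed

text \<open>At a fixed vector the rows are independent, so the characteristic function of the sum is
  a product. Two products of numbers of modulus at most 1 differ by at most the sum of the
  differences of their factors.\<close>

lemma rows_char_approx:
  fixes a :: "nat \<Rightarrow> real"
  assumes n: "n > 0"
  shows "cmod (expectation (\<lambda>\<omega>. iexp (s * (\<Sum>i<m. row_excess n a (\<lambda>j. S i j \<omega>)))) - exp (- (s\<^sup>2)) ^ m)
    \<le> (\<Sum>i<m. s\<^sup>2 / 6 * remainder n s a i + s\<^sup>2 / 2 * \<bar>row_variance n \<kappa> a - 2\<bar> + s ^ 4)"
proof -
  define Z where "Z = (\<lambda>i \<omega>. row_excess n a (\<lambda>j. S i j \<omega>))"
  define \<psi> where "\<psi> i = expectation (\<lambda>\<omega>. iexp (s * Z i \<omega>))" for i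
  have [measurable]: "Z i \<in> borel_measurable M" for i unfolding Z_def row_excess_def by measurable
  have "indep_vars (\<lambda>_. borel)
      (\<lambda>i \<omega>. (\<lambda>f. iexp (s * row_excess n a (\<lambda>j. f (Inr (i, j))))) (restrict (\<lambda>k. entry k \<omega>) (range (\<lambda>j. Inr (i, j))))) {..<m}"
    unfolding row_excess_def
    by (rule indep_vars_blocks) (auto simp: disjoint_family_on_def)
  then have ind: "indep_vars (\<lambda>_. borel) (\<lambda>i \<omega>. iexp (s * Z i \<omega>)) {..<m}" by (simp add: Z_def)
  have "expectation (\<lambda>\<omega>. iexp (s * (\<Sum>i<m. Z i \<omega>))) = expectation (\<lambda>\<omega>. \<Prod>i<m. iexp (s * Z i \<omega>))"
    by (simp add: sum_distrib_left exp_sum)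
  also have "\<dots> = (\<Prod>i<m. \<psi> i)"
    unfolding \<psi>_def by (rule indep_vars_lebesgue_integral[OF _ ind]) (auto intro!: integrable_iexp)
  finally have prod: "expectation (\<lambda>\<omega>. iexp (s * (\<Sum>i<m. Z i \<omega>))) = (\<Prod>i<m. \<psi> i)" .
  have \<psi>1: "cmod (\<psi> i) \<le> 1" for i
    unfolding \<psi>_def
    by (rule order_trans[OF integral_norm_bound]) (simp add: prob_space)
  have "cmod ((\<Prod>i<m. \<psi> i) - (\<Prod>i<m. complex_of_real (exp (- (s\<^sup>2))))) \<le> (\<Sum>i<m. cmod (\<psi> i - exp (- (s\<^sup>2))))"
    by (rule norm_prod_diff) (simp_all add: \<psi>1)
  also have "\<dots> \<le> (\<Sum>i<m. s\<^sup>2 / 6 * remainder n s a i + s\<^sup>2 / 2 * \<bar>row_variance n \<kappa> a - 2\<bar> + s ^ 4)"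
    unfolding \<psi>_def Z_def by (intro sum_mono row_char_approx n)
  finally show ?thesis using prod by (simp add: Z_def)
qed

subsection \<open>Averaging over the vector\<close>

lemma mean_square_measurable [measurable]: "(\<lambda>\<omega>. mean_square n (\<lambda>j. x j \<omega>)) \<in> borel_measurable M"
  unfolding mean_square_def by measurable

text \<open>The centred squares of the vector entries are independent with variance
  \<open>(1 + \<sigma>\<^sup>2) - 2 + 1 = \<sigma>\<^sup>2\<close>, and \<open>q - 1\<close> is
  their average.\<close>

lemma mean_square_variance:
  assumes n: "n > 0"
  defines "q \<equiv> \<lambda>\<omega>. mean_square n (\<lambda>j. x j \<omega>)"
  shows "integrable M (\<lambda>\<omega>. (q \<omega> - 1)\<^sup>2)" "expectation (\<lambda>\<omega>. (q \<omega> - 1)\<^sup>2) = \<sigma>\<^sup>2 / real n"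
proof -
  have "indep_vars (\<lambda>_. borel)
      (\<lambda>j \<omega>. (\<lambda>f. (f (Inl j))\<^sup>2 - 1) (restrict (\<lambda>k. entry k \<omega>) {Inl j})) {..<n}"
    by (rule indep_vars_blocks) (auto simp: disjoint_family_on_def)
  then have ind: "indep_vars (\<lambda>_. borel) (\<lambda>j \<omega>. (x j \<omega>)\<^sup>2 - 1) {..<n}" by simp
  have e: "((x j \<omega>)\<^sup>2 - 1)\<^sup>2 = x j \<omega> ^ 4 - 2 * (x j \<omega>)\<^sup>2 + 1" for j \<omega>
    by (simp add: power2_diff flip: power_mult)
  have i2: "integrable M (\<lambda>\<omega>. ((x j \<omega>)\<^sup>2 - 1)\<^sup>2)" for j
    unfolding e using entry_integrable(1)[of 4] entry_integrable(1)[of 2] by simp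
  have m1: "expectation (\<lambda>\<omega>. (x j \<omega>)\<^sup>2 - 1) = 0" for j
    using entry_integrable(1)[of 2] by (simp add: entry_moments prob_space)
  have m2: "expectation (\<lambda>\<omega>. ((x j \<omega>)\<^sup>2 - 1)\<^sup>2) = \<sigma>\<^sup>2" for j
    unfolding e using entry_integrable(1)[of 4] entry_integrable(1)[of 2] by (simp add: entry_moments prob_space)
  have q: "(q \<omega> - 1)\<^sup>2 = (\<Sum>j<n. (x j \<omega>)\<^sup>2 - 1)\<^sup>2 / (real n)\<^sup>2" for \<omega>
    using n by (simp add: q_def mean_square_def sum_subtractf power_divide diff_divide_distrib flip: power_divide)
  show "integrable M (\<lambda>\<omega>. (q \<omega> - 1)\<^sup>2)" "expectation (\<lambda>\<omega>. (q \<omega> - 1)\<^sup>2) = \<sigma>\<^sup>2 / real n"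
    using indep_sum_moments_2[OF ind i2 m1] n by (simp_all add: q m2) (simp add: power2_eq_square)
qed

lemma mean_square_abs_deviation:
  assumes n: "n > 0"
  defines "q \<equiv> \<lambda>\<omega>. mean_square n (\<lambda>j. x j \<omega>)"
  shows "integrable M (\<lambda>\<omega>. \<bar>q \<omega> - 1\<bar>)" "expectation (\<lambda>\<omega>. \<bar>q \<omega> - 1\<bar>) \<le> (1 + \<sigma>\<^sup>2) / (2 * sqrt (real n))"
proof -
  note var = mean_square_variance[OF n]
  \<comment> \<open>This weight balances the two terms of \<open>abs_le_weighted_square\<close>,
    since the mean of \<open>(q - 1)\<^sup>2\<close> is of order \<open>1 / n\<close>; both become
    of order \<open>1 / sqrt n\<close>.\<close>
  define d where "d = 1 / sqrt (real n)"
  have d: "d > 0" using n by (simp add: d_def)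
  have [measurable]: "q \<in> borel_measurable M" unfolding q_def by measurable
  have le: "\<bar>q \<omega> - 1\<bar> \<le> (d + (q \<omega> - 1)\<^sup>2 / d) / 2" for \<omega> by (rule abs_le_weighted_square[OF d])
  have ib: "integrable M (\<lambda>\<omega>. (d + (q \<omega> - 1)\<^sup>2 / d) / 2)" using var by (simp add: q_def)
  show i: "integrable M (\<lambda>\<omega>. \<bar>q \<omega> - 1\<bar>)"
    by (rule Bochner_Integration.integrable_bound[OF ib]) (use le in \<open>auto intro: order_trans[OF _ abs_ge_self]\<close>)
  have "expectation (\<lambda>\<omega>. \<bar>q \<omega> - 1\<bar>) \<le> expectation (\<lambda>\<omega>. (d + (q \<omega> - 1)\<^sup>2 / d) / 2)"
    by (rule integral_mono[OF i ib le])
  also have "\<dots> = (d + \<sigma>\<^sup>2 / real n / d) / 2" using var by (simp add: q_def prob_space)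
  also have "\<dots> = (1 + \<sigma>\<^sup>2) / (2 * sqrt (real n))"
    using n by (simp add: d_def field_simps)
  finally show "expectation (\<lambda>\<omega>. \<bar>q \<omega> - 1\<bar>) \<le> (1 + \<sigma>\<^sup>2) / (2 * sqrt (real n))" .
qed

definition variance_error :: "nat \<Rightarrow> real" where
  "variance_error n = 2 * \<sigma>\<^sup>2 / real n + 2 * (1 + \<sigma>\<^sup>2) / sqrt (real n) + \<bar>\<kappa> - 3\<bar> * (1 + \<sigma>\<^sup>2) / real n"

text \<open>Since \<open>2 * q\<^sup>2 - 2 = 2 * (q - 1)\<^sup>2 + 4 * (q - 1)\<close>, the bounds
  on the deviation of \<open>q\<close> and the fourth moment of the vector entries suffice. They
  produce the three summands of \<open>variance_error\<close> in this order.\<close>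

lemma row_variance_deviation:
  assumes n: "n > 0"
  defines "v \<equiv> \<lambda>\<omega>. row_variance n \<kappa> (\<lambda>j. x j \<omega>)"
  shows "integrable M (\<lambda>\<omega>. \<bar>v \<omega> - 2\<bar>)" "expectation (\<lambda>\<omega>. \<bar>v \<omega> - 2\<bar>) \<le> variance_error n"
proof -
  define q where "q \<omega> = mean_square n (\<lambda>j. x j \<omega>)" for \<omega>
  have [measurable]: "q \<in> borel_measurable M" unfolding q_def by measurable
  have [measurable]: "v \<in> borel_measurable M" unfolding v_def row_variance_def by measurable
  note var = mean_square_variance[OF n, folded q_def] and dev = mean_square_abs_deviation[OF n, folded q_def]
  define b where "b \<omega> = 2 * (q \<omega> - 1)\<^sup>2 + 4 * \<bar>q \<omega> - 1\<bar> + \<bar>\<kappa> - 3\<bar> * (\<Sum>j<n. x j \<omega> ^ 4) / (real n)\<^sup>2" for \<omega>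
  have le: "\<bar>v \<omega> - 2\<bar> \<le> b \<omega>" for \<omega>
  proof -
    have "v \<omega> - 2 = 2 * (q \<omega> - 1)\<^sup>2 + 4 * (q \<omega> - 1) + (\<kappa> - 3) * (\<Sum>j<n. x j \<omega> ^ 4) / (real n)\<^sup>2"
      by (simp add: v_def row_variance_def power2_eq_square algebra_simps flip: q_def)
    also have "\<bar>\<dots>\<bar> \<le> \<bar>2 * (q \<omega> - 1)\<^sup>2\<bar> + \<bar>4 * (q \<omega> - 1)\<bar> + \<bar>(\<kappa> - 3) * (\<Sum>j<n. x j \<omega> ^ 4) / (real n)\<^sup>2\<bar>"
      by linarith
    also have "\<bar>4 * (q \<omega> - 1)\<bar> = 4 * \<bar>q \<omega> - 1\<bar>" by (simp only: abs_mult abs_numeral)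
    also have "\<bar>2 * (q \<omega> - 1)\<^sup>2\<bar> + 4 * \<bar>q \<omega> - 1\<bar> + \<bar>(\<kappa> - 3) * (\<Sum>j<n. x j \<omega> ^ 4) / (real n)\<^sup>2\<bar> = b \<omega>"
      by (simp add: b_def abs_mult abs_of_nonneg[OF sum_nonneg])
    finally show ?thesis .
  qed
  have ib: "integrable M b"
    unfolding b_def using var dev entry_integrable(1)[of 4] by simp
  show i: "integrable M (\<lambda>\<omega>. \<bar>v \<omega> - 2\<bar>)"
    by (rule Bochner_Integration.integrable_bound[OF ib]) (use le in \<open>auto intro: order_trans[OF _ abs_ge_self]\<close>)
  have "expectation (\<lambda>\<omega>. \<bar>v \<omega> - 2\<bar>) \<le> expectation b" by (rule integral_mono[OF i ib le])
  also have "\<dots> = 2 * (\<sigma>\<^sup>2 / real n) + 4 * expectation (\<lambda>\<omega>. \<bar>q \<omega> - 1\<bar>) + \<bar>\<kappa> - 3\<bar> * (real n * (1 + \<sigma>\<^sup>2)) / (real n)\<^sup>2"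
    unfolding b_def using var dev entry_integrable(1)[of 4] by (simp add: entry_moments)
  also have "\<dots> \<le> variance_error n"
  proof -
    have "4 * expectation (\<lambda>\<omega>. \<bar>q \<omega> - 1\<bar>) \<le> 2 * (1 + \<sigma>\<^sup>2) / sqrt (real n)"
    proof -
      have "4 * ((1 + \<sigma>\<^sup>2) / (2 * sqrt (real n))) = 2 * (1 + \<sigma>\<^sup>2) / sqrt (real n)"
        using n by (simp add: field_simps)
      then show ?thesis using dev(2) by linarith
    qed
    then show ?thesis using n by (simp add: variance_error_def power2_eq_square)
  qed
  finally show "expectation (\<lambda>\<omega>. \<bar>v \<omega> - 2\<bar>) \<le> variance_error n" .
qed

section \<open>Row sums without conditioning\<close>

lemma product_indep: "indep_vars (\<lambda>_. borel) (\<lambda>j \<omega>. S i j \<omega> * x j \<omega>) UNIV"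
proof -
  have "indep_vars (\<lambda>_. borel)
      (\<lambda>j \<omega>. (\<lambda>f. f (Inr (i, j)) * f (Inl j)) (restrict (\<lambda>k. entry k \<omega>) {Inl j, Inr (i, j)})) UNIV"
    by (rule indep_vars_blocks) (auto simp: disjoint_family_on_def)
  then show ?thesis by simp
qed

lemma S_x_indep: "indep_var borel (S i j) borel (x l)"
proof -
  have "indep_var borel ((\<lambda>f. f (Inr (i, j))) \<circ> (\<lambda>\<omega>. restrict (\<lambda>k. entry k \<omega>) {Inr (i, j)}))
     borel ((\<lambda>f. f (Inl l)) \<circ> (\<lambda>\<omega>. restrict (\<lambda>k. entry k \<omega>) {Inl l}))"
    by (rule indep_var_compose[OF indep_var_restrict[OF indep]]) auto
  then show ?thesis by (simp add: comp_def)
qed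

lemma product_ident: "distr M borel (\<lambda>\<omega>. S i j \<omega> * x j \<omega>) = distr M borel (\<lambda>\<omega>. S 0 0 \<omega> * x 0 \<omega>)"
proof -
  have *: "distr M borel (\<lambda>\<omega>. S i j \<omega> * x j \<omega>)
      = distr (distr M borel (S 0 0) \<Otimes>\<^sub>M distr M borel (x 0)) borel (\<lambda>p. fst p * snd p)" for i j
  proof -
    have "distr M borel (S i j) \<Otimes>\<^sub>M distr M borel (x j) = distr M (borel \<Otimes>\<^sub>M borel) (\<lambda>\<omega>. (S i j \<omega>, x j \<omega>))"
      using S_x_indep[of i j j] by (simp add: indep_var_distribution_eq)
    then show ?thesis
      unfolding S_ident[of i j] x_ident[of j] by (simp add: distr_distr comp_def)
  qed
  show ?thesis by (simp only: *[of i j] *[of 0 0])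
qed

text \<open>Within one row the products are independent with a common law that is the same for every
  row, so the characteristic function of the sum does not depend on \<open>i\<close>.\<close>

lemma row_sum_ident:
  "distr M borel (\<lambda>\<omega>. \<Sum>j<n. S i j \<omega> * x j \<omega>) = distr M borel (\<lambda>\<omega>. \<Sum>j<n. S 0 j \<omega> * x j \<omega>)"
proof (rule Levy_uniqueness)
  have "char (distr M borel (\<lambda>\<omega>. \<Sum>j<n. S i j \<omega> * x j \<omega>)) t
      = (\<Prod>j<n. char (distr M borel (\<lambda>\<omega>. S 0 0 \<omega> * x 0 \<omega>)) t)" for i t
    by (subst char_distr_sum[OF indep_vars_subset[OF product_indep]]) (simp_all add: product_ident[of i])
  then show "char (distr M borel (\<lambda>\<omega>. \<Sum>j<n. S i j \<omega> * x j \<omega>))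
      = char (distr M borel (\<lambda>\<omega>. \<Sum>j<n. S 0 j \<omega> * x j \<omega>))"
    by (intro ext) metis
qed (simp_all add: real_distribution_distr)

lemma product_moments:
  shows "integrable M (\<lambda>\<omega>. (S i j \<omega> * x j \<omega>) ^ 4)" "expectation (\<lambda>\<omega>. S i j \<omega> * x j \<omega>) = 0"
    "expectation (\<lambda>\<omega>. (S i j \<omega> * x j \<omega>)\<^sup>2) = 1"
proof -
  note pm = indep_var_power_mult[OF S_x_indep entry_integrable(2,1), of _ _ i j j]
  show "integrable M (\<lambda>\<omega>. (S i j \<omega> * x j \<omega>) ^ 4)" "expectation (\<lambda>\<omega>. S i j \<omega> * x j \<omega>) = 0"
    "expectation (\<lambda>\<omega>. (S i j \<omega> * x j \<omega>)\<^sup>2) = 1"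
    using pm(1)[of 4 4] pm(2)[of 1 1] pm(2)[of 2 2] by (simp_all add: power_mult_distrib entry_moments)
qed

definition row_sum :: "nat \<Rightarrow> nat \<Rightarrow> 'a \<Rightarrow> real" where
  "row_sum n i \<omega> = (\<Sum>j<n. S i j \<omega> * x j \<omega>) / sqrt (real n)"

lemma row_sum_measurable [measurable]: "row_sum n i \<in> borel_measurable M"
  unfolding row_sum_def by measurable

lemma excess_eq: "excess n i \<omega> = (row_sum n i \<omega>)\<^sup>2 - mean_square n (\<lambda>j. x j \<omega>)"
  by (simp add: row_excess_def row_sum_def power_divide)

lemma row_sum_integrable_4: "integrable M (\<lambda>\<omega>. row_sum n i \<omega> ^ 4)"
  using indep_sum_moments_4[OF indep_vars_subset[OF product_indep] product_moments(1,2), of n i]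
  by (simp add: row_sum_def power_divide)

text \<open>Row 0 represents all rows, which have equal laws by
  \<open>row_sum_ident\<close>.\<close>

definition truncation_tail :: "nat \<Rightarrow> real \<Rightarrow> real" where
  "truncation_tail n s = expectation (\<lambda>\<omega>. min (row_sum n 0 \<omega> ^ 4) (\<bar>s\<bar> * row_sum n 0 \<omega> ^ 6))"

lemma truncation_tail_row: "expectation (\<lambda>\<omega>. min (row_sum n i \<omega> ^ 4) (\<bar>s\<bar> * row_sum n i \<omega> ^ 6)) = truncation_tail n s"
proof -
  \<comment> \<open>The normalisation is moved into the test function because
    \<open>row_sum_ident\<close> compares the unnormalised sums.\<close>
  define f where "f y = min ((y / sqrt (real n)) ^ 4) (\<bar>s\<bar> * (y / sqrt (real n)) ^ 6)" for y :: real
  have f [measurable]: "f \<in> borel_measurable borel" unfolding f_def by measurable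
  have "expectation (\<lambda>\<omega>. f (\<Sum>j<n. S i j \<omega> * x j \<omega>))
      = integral\<^sup>L (distr M borel (\<lambda>\<omega>. \<Sum>j<n. S i j \<omega> * x j \<omega>)) f" for i
    by (subst integral_distr) auto
  from this[of i] this[of 0] show ?thesis
    unfolding row_sum_ident[where n = n and i = i] truncation_tail_def row_sum_def f_def by (simp only:)
qed

lemma truncation_tail_tendsto_0:
  assumes "filterlim n at_top sequentially" "s \<longlonglongrightarrow> 0"
  shows "(\<lambda>k. truncation_tail (n k) (s k)) \<longlonglongrightarrow> 0"
  unfolding truncation_tail_def row_sum_def
  by (rule iid_sum_fourth_power_uniformly_integrable[OF product_indep product_moments product_ident assms])

text \<open>Averaging the conditional remainder over the vector undoes the decoupling and leaves an
  unconditional mean in which the row sum is a sum of i.i.d. products. The bound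
  \<open>min_square_cube_diff_le\<close> then separates the row sum from the fluctuation of
  \<open>q\<close>.\<close>

lemma remainder_expectation:
  assumes n: "n > 0"
  shows "integrable M (\<lambda>\<omega>. remainder n s (\<lambda>j. x j \<omega>) i)"
    and "expectation (\<lambda>\<omega>. remainder n s (\<lambda>j. x j \<omega>) i) \<le> 6 * truncation_tail n s + 8 * \<bar>s\<bar> + 24 * (\<sigma>\<^sup>2 / real n)"
proof -
  define q where "q \<omega> = mean_square n (\<lambda>j. x j \<omega>)" for \<omega>
  have [measurable]: "q \<in> borel_measurable M" unfolding q_def by measurable
  have q0: "q \<omega> \<ge> 0" for \<omega> by (simp add: q_def mean_square_def sum_nonneg)
  note var = mean_square_variance[OF n, folded q_def]
  define F where "F a b = min (6 * (row_excess n a (b i))\<^sup>2) (\<bar>s\<bar> * \<bar>row_excess n a (b i)\<bar> ^ 3)" for a and b :: "nat \<Rightarrow> nat \<Rightarrow> real"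
  define B where "B \<omega> = 6 * min (row_sum n i \<omega> ^ 4) (\<bar>s\<bar> * row_sum n i \<omega> ^ 6) + 8 * \<bar>s\<bar> + 24 * (q \<omega> - 1)\<^sup>2" for \<omega>
  have FB: "F (\<lambda>j. x j \<omega>) (\<lambda>i j. S i j \<omega>) \<le> B \<omega>" for \<omega>
    unfolding F_def B_def excess_eq q_def[symmetric] by (rule min_square_cube_diff_le[OF q0])
  have F0: "F a b \<ge> 0" for a b by (simp add: F_def)
  have FM: "(\<lambda>\<omega>. F (\<lambda>j. x j \<omega>) (\<lambda>i j. S i j \<omega>)) \<in> borel_measurable M"
    unfolding F_def excess_eq by measurable
  have iT: "integrable M (\<lambda>\<omega>. min (row_sum n i \<omega> ^ 4) (\<bar>s\<bar> * row_sum n i \<omega> ^ 6))"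
    by (rule Bochner_Integration.integrable_bound[OF row_sum_integrable_4[of n i]]) auto
  have iB: "integrable M B" unfolding B_def using iT var by simp
  have iF: "integrable M (\<lambda>\<omega>. F (\<lambda>j. x j \<omega>) (\<lambda>i j. S i j \<omega>))"
    by (rule Bochner_Integration.integrable_bound[OF iB FM])
       (use FB F0 in \<open>auto intro!: order_trans[OF _ abs_ge_self]\<close>)
  have mF: "(\<lambda>p. F (\<lambda>j. fst p (Inl j)) (\<lambda>i j. snd p (Inr (i, j)))) \<in> borel_measurable (vector_space \<Otimes>\<^sub>M matrix_space)"
    unfolding F_def row_excess_def mean_square_def by measurable
  have rem: "remainder n s a i = (\<integral>\<omega>'. F a (\<lambda>i j. S i j \<omega>') \<partial>M)" for a
    by (simp add: remainder_def F_def)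
  show "integrable M (\<lambda>\<omega>. remainder n s (\<lambda>j. x j \<omega>) i)"
    unfolding rem by (rule decouple(1)[OF mF iF])
  have "expectation (\<lambda>\<omega>. remainder n s (\<lambda>j. x j \<omega>) i) = expectation (\<lambda>\<omega>. F (\<lambda>j. x j \<omega>) (\<lambda>i j. S i j \<omega>))"
    unfolding rem by (rule decouple(2)[OF mF iF, symmetric])
  also have "\<dots> \<le> expectation B" by (rule integral_mono[OF iF iB FB])
  also have "\<dots> = 6 * truncation_tail n s + 8 * \<bar>s\<bar> + 24 * (\<sigma>\<^sup>2 / real n)"
    unfolding B_def using iT var by (simp add: truncation_tail_row prob_space)
  finally show "expectation (\<lambda>\<omega>. remainder n s (\<lambda>j. x j \<omega>) i) \<le> 6 * truncation_tail n s + 8 * \<bar>s\<bar> + 24 * (\<sigma>\<^sup>2 / real n)" .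
qed

section \<open>Characteristic function of the sketch\<close>

definition char_error :: "nat \<Rightarrow> real \<Rightarrow> real" where
  "char_error n s = (6 * truncation_tail n s + 8 * \<bar>s\<bar> + 24 * (\<sigma>\<^sup>2 / real n)) / 6 + variance_error n / 2 + s\<^sup>2"

text \<open>The comparison value in \<open>rows_char_approx\<close> does not depend on the vector,
  so that bound can be averaged over the vector term by term.\<close>

lemma excess_char_approx:
  assumes n: "n > 0"
  shows "cmod (expectation (\<lambda>\<omega>. iexp (s * (\<Sum>i<m. excess n i \<omega>))) - exp (- (s\<^sup>2)) ^ m)
    \<le> real m * s\<^sup>2 * char_error n s"
proof -
  define F where "F a b = iexp (s * (\<Sum>i<m. row_excess n a (b i)))" for a and b :: "nat \<Rightarrow> nat \<Rightarrow> real"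
  define c :: complex where "c = exp (- (s\<^sup>2)) ^ m"
  have mF: "(\<lambda>p. F (\<lambda>j. fst p (Inl j)) (\<lambda>i j. snd p (Inr (i, j)))) \<in> borel_measurable (vector_space \<Otimes>\<^sub>M matrix_space)"
    unfolding F_def row_excess_def mean_square_def by measurable
  have FM [measurable]: "(\<lambda>\<omega>. F (\<lambda>j. x j \<omega>) (\<lambda>i j. S i j \<omega>)) \<in> borel_measurable M"
    unfolding F_def excess_eq by measurable
  have F1: "cmod (F a b) = 1" for a b
    unfolding F_def by (rule norm_exp_i_times)
  have iF: "integrable M (\<lambda>\<omega>. F (\<lambda>j. x j \<omega>) (\<lambda>i j. S i j \<omega>))"
    by (rule integrable_const_bound[where B = 1, OF _ FM]) (simp add: F1)
  define \<Psi> where "\<Psi> \<omega> = (\<integral>\<omega>'. F (\<lambda>j. x j \<omega>) (\<lambda>i j. S i j \<omega>') \<partial>M)" for \<omega>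
  have i\<Psi>: "integrable M \<Psi>" and E\<Psi>: "expectation (\<lambda>\<omega>. F (\<lambda>j. x j \<omega>) (\<lambda>i j. S i j \<omega>)) = expectation \<Psi>"
    using decouple[OF mF iF] by (simp_all add: \<Psi>_def[abs_def])
  define B where "B \<omega> = (\<Sum>i<m. s\<^sup>2 / 6 * remainder n s (\<lambda>j. x j \<omega>) i
      + s\<^sup>2 / 2 * \<bar>row_variance n \<kappa> (\<lambda>j. x j \<omega>) - 2\<bar> + s ^ 4)" for \<omega>
  have le: "cmod (\<Psi> \<omega> - c) \<le> B \<omega>" for \<omega>
    unfolding \<Psi>_def F_def c_def B_def using rows_char_approx[OF n, where a = "\<lambda>j. x j \<omega>" and s = s and m = m] by simp
  note parts = remainder_expectation[OF n] row_variance_deviation[OF n]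
  have iB: "integrable M B" unfolding B_def using parts(1,3) by simp
  have "expectation \<Psi> - c = expectation (\<lambda>\<omega>. \<Psi> \<omega> - c)"
    using i\<Psi> by (simp add: prob_space)
  also have "cmod \<dots> \<le> expectation (\<lambda>\<omega>. cmod (\<Psi> \<omega> - c))" by (rule integral_norm_bound)
  also have "\<dots> \<le> expectation B" using i\<Psi> by (intro integral_mono iB le) auto
  also have "\<dots> = (\<Sum>i<m. s\<^sup>2 / 6 * expectation (\<lambda>\<omega>. remainder n s (\<lambda>j. x j \<omega>) i)
      + s\<^sup>2 / 2 * expectation (\<lambda>\<omega>. \<bar>row_variance n \<kappa> (\<lambda>j. x j \<omega>) - 2\<bar>) + s ^ 4)"
    unfolding B_def using parts(1,3) by (simp add: prob_space)
  also have "\<dots> \<le> (\<Sum>i<m. s\<^sup>2 / 6 * (6 * truncation_tail n s + 8 * \<bar>s\<bar> + 24 * (\<sigma>\<^sup>2 / real n))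
      + s\<^sup>2 / 2 * variance_error n + s ^ 4)"
    by (intro sum_mono add_mono mult_left_mono parts) auto
  \<comment> \<open>A factor \<open>s\<^sup>2\<close> is split off every error term because
    \<open>m * s\<^sup>2\<close> will stay bounded in the limit; it then suffices that
    \<open>char_error\<close> vanishes.\<close>
  also have "\<dots> = real m * s\<^sup>2 * char_error n s"
    by (simp add: char_error_def power_numeral_reduce algebra_simps)
  finally show ?thesis unfolding E\<Psi>[symmetric] by (simp add: F_def c_def)
qed

text \<open>The exponential of an imaginary argument is 1-Lipschitz, so the extra summand
  \<open>m * (q - 1)\<close> costs at most \<open>m * \<bar>s\<bar>\<close> times the mean absolute
  deviation of \<open>q\<close>.\<close>

lemma sketch_char_approx:
  assumes n: "n > 0"
  shows "cmod (expectation (\<lambda>\<omega>. iexp (s * ((\<Sum>i<m. excess n i \<omega>)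
        + real m * (mean_square n (\<lambda>j. x j \<omega>) - 1)))) - exp (- (s\<^sup>2)) ^ m)
    \<le> real m * s\<^sup>2 * char_error n s + real m * \<bar>s\<bar> * ((1 + \<sigma>\<^sup>2) / (2 * sqrt (real n)))"
proof -
  define q where "q \<omega> = mean_square n (\<lambda>j. x j \<omega>)" for \<omega>
  define T where "T \<omega> = (\<Sum>i<m. excess n i \<omega>)" for \<omega>
  have [measurable]: "q \<in> borel_measurable M" unfolding q_def by measurable
  have [measurable]: "T \<in> borel_measurable M" unfolding T_def excess_eq by measurable
  note dev = mean_square_abs_deviation[OF n, folded q_def]
  have i1: "integrable M (\<lambda>\<omega>. iexp (s * (T \<omega> + real m * (q \<omega> - 1))))"
    and i2: "integrable M (\<lambda>\<omega>. iexp (s * T \<omega>))"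
    by (rule integrable_const_bound[where B = 1]; simp)+
  have le: "cmod (iexp (s * (T \<omega> + real m * (q \<omega> - 1))) - iexp (s * T \<omega>)) \<le> real m * \<bar>s\<bar> * \<bar>q \<omega> - 1\<bar>" for \<omega>
  proof -
    have "iexp (s * (T \<omega> + real m * (q \<omega> - 1))) - iexp (s * T \<omega>)
        = iexp (s * T \<omega>) * (iexp (s * real m * (q \<omega> - 1)) - 1)"
      by (simp add: algebra_simps flip: exp_add)
    then have "cmod (iexp (s * (T \<omega> + real m * (q \<omega> - 1))) - iexp (s * T \<omega>))
        = cmod (iexp (s * real m * (q \<omega> - 1)) - 1)"
      by (simp only: norm_mult norm_exp_i_times mult_1)
    also have "\<dots> \<le> \<bar>s * real m * (q \<omega> - 1)\<bar>"
      using iexp_approx1[of "s * real m * (q \<omega> - 1)" 0] by simp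
    finally show ?thesis by (simp add: abs_mult mult_ac)
  qed
  have "cmod (expectation (\<lambda>\<omega>. iexp (s * (T \<omega> + real m * (q \<omega> - 1)))) - expectation (\<lambda>\<omega>. iexp (s * T \<omega>)))
      = cmod (expectation (\<lambda>\<omega>. iexp (s * (T \<omega> + real m * (q \<omega> - 1))) - iexp (s * T \<omega>)))"
    using i1 i2 by simp
  also have "\<dots> \<le> expectation (\<lambda>\<omega>. cmod (iexp (s * (T \<omega> + real m * (q \<omega> - 1))) - iexp (s * T \<omega>)))"
    by (rule integral_norm_bound)
  also have "\<dots> \<le> expectation (\<lambda>\<omega>. real m * \<bar>s\<bar> * \<bar>q \<omega> - 1\<bar>)"
    using i1 i2 dev by (intro integral_mono le) auto
  also have "\<dots> = real m * \<bar>s\<bar> * expectation (\<lambda>\<omega>. \<bar>q \<omega> - 1\<bar>)" by simp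
  also have "\<dots> \<le> real m * \<bar>s\<bar> * ((1 + \<sigma>\<^sup>2) / (2 * sqrt (real n)))"
    by (intro mult_left_mono dev) auto
  finally have "cmod (expectation (\<lambda>\<omega>. iexp (s * (T \<omega> + real m * (q \<omega> - 1)))) - expectation (\<lambda>\<omega>. iexp (s * T \<omega>)))
      \<le> real m * \<bar>s\<bar> * ((1 + \<sigma>\<^sup>2) / (2 * sqrt (real n)))" .
  then show ?thesis
    using excess_char_approx[OF n, of s m]
      norm_triangle_ineq[of "expectation (\<lambda>\<omega>. iexp (s * (T \<omega> + real m * (q \<omega> - 1)))) - expectation (\<lambda>\<omega>. iexp (s * T \<omega>))"
        "expectation (\<lambda>\<omega>. iexp (s * T \<omega>)) - exp (- (s\<^sup>2)) ^ m"]
    unfolding T_def q_def by simp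
qed

subsection \<open>Passage to the limit\<close>

text \<open>By Levy's continuity theorem it suffices that the characteristic functions converge
  pointwise. At each \<open>t\<close> the bound of \<open>sketch_char_approx\<close> is applied with
  a suitably rescaled argument \<open>s k\<close>.\<close>

lemma sketch_central_limit:
  fixes \<xi> :: real and mk nk :: "nat \<Rightarrow> nat"
  assumes m_lim: "filterlim mk at_top sequentially"
    and n_lim: "filterlim nk at_top sequentially"
    and ratio_lim: "(\<lambda>k. real (mk k) / real (nk k)) \<longlonglongrightarrow> 0"
  defines "\<Delta> \<equiv> \<lambda>k. \<sigma>\<^sup>2 * (real (mk k))\<^sup>2 * real (nk k) + 2 * real (mk k) * (real (nk k))\<^sup>2 + \<xi> * real (mk k) * real (nk k)"
  shows "weak_conv_m
           (\<lambda>k. distr M borel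
              (\<lambda>\<omega>. (sq_norm_SX (mk k) (nk k) (\<lambda>i j. S i j \<omega>) (\<lambda>j. x j \<omega>) - real (mk k) * real (nk k)) / sqrt (\<Delta> k)))
           std_normal_distribution"
proof (rule levy_continuity)
  define A where "A k \<omega> = (sq_norm_SX (mk k) (nk k) (\<lambda>i j. S i j \<omega>) (\<lambda>j. x j \<omega>) - real (mk k) * real (nk k)) / sqrt (\<Delta> k)" for k \<omega>
  have A [measurable]: "A k \<in> borel_measurable M" for k
    unfolding A_def sq_norm_SX_def by measurable
  show "real_distribution (distr M borel (A k))" for k
    by (rule real_distribution_distr) simp
  show "real_distribution std_normal_distribution" by (rule real_dist_normal_dist)
  fix t :: real
  have nr: "filterlim (\<lambda>k. real (nk k)) at_top sequentially" and mr: "filterlim (\<lambda>k. real (mk k)) at_top sequentially"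
    by (rule filterlim_compose[OF filterlim_real_sequentially n_lim] filterlim_compose[OF filterlim_real_sequentially m_lim])+
  have div_n: "(\<lambda>k. c / real (nk k)) \<longlonglongrightarrow> 0" and div_m: "(\<lambda>k. c / real (mk k)) \<longlonglongrightarrow> 0" for c
    by (rule tendsto_divide_0[OF tendsto_const] filterlim_at_top_imp_at_infinity nr mr)+
  have div_sqrt: "(\<lambda>k. c / sqrt (real (nk k))) \<longlonglongrightarrow> 0" for c
    by (intro tendsto_divide_0[OF tendsto_const] filterlim_at_top_imp_at_infinity filterlim_compose[OF sqrt_at_top nr])
  have pos: "\<forall>\<^sub>F k in sequentially. mk k > 0 \<and> nk k > 0"
    using eventually_compose_filterlim[OF eventually_gt_at_top m_lim] eventually_compose_filterlim[OF eventually_gt_at_top n_lim]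
    by eventually_elim simp
  \<comment> \<open>This is \<open>\<Delta>\<close> divided by its dominant scale
    \<open>m * n\<^sup>2\<close>; the limit 2 comes from the middle term.\<close>
  define \<delta> where "\<delta> k = \<sigma>\<^sup>2 * (real (mk k) / real (nk k)) + 2 + \<xi> / real (nk k)" for k
  have "\<delta> \<longlonglongrightarrow> \<sigma>\<^sup>2 * 0 + 2 + 0" unfolding \<delta>_def by (intro tendsto_intros ratio_lim div_n)
  then have \<delta>: "\<delta> \<longlonglongrightarrow> 2" by simp
  have \<delta>pos: "\<forall>\<^sub>F k in sequentially. \<delta> k > 0" by (rule order_tendstoD[OF \<delta>]) simp
  have \<Delta>: "\<Delta> k = real (mk k) * (real (nk k))\<^sup>2 * \<delta> k" if "nk k > 0" for k
    using that by (simp add: \<Delta>_def \<delta>_def field_simps power2_eq_square)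

  \<comment> \<open>The factor \<open>n\<close> appears because the centred squared norm is
    \<open>n\<close> times the sum of the row excesses and \<open>m * (q - 1)\<close>.\<close>
  define s where "s k = t * real (nk k) / sqrt (\<Delta> k)" for k
  have ms_eq: "\<forall>\<^sub>F k in sequentially. t\<^sup>2 / \<delta> k = real (mk k) * (s k)\<^sup>2"
    using pos \<delta>pos
  proof eventually_elim
    case (elim k)
    then have "\<Delta> k > 0" by (simp add: \<Delta>)
    then have "real (mk k) * (s k)\<^sup>2 = real (mk k) * (t * real (nk k))\<^sup>2 / \<Delta> k"
      by (simp add: s_def power_divide)
    then show ?case using elim by (simp add: \<Delta> field_simps)
  qed
  have "(\<lambda>k. t\<^sup>2 / \<delta> k) \<longlonglongrightarrow> t\<^sup>2 / 2" by (intro tendsto_intros \<delta>) simp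
  then have ms: "(\<lambda>k. real (mk k) * (s k)\<^sup>2) \<longlonglongrightarrow> t\<^sup>2 / 2"
    using ms_eq by (rule Lim_transform_eventually)
  \<comment> \<open>As \<open>m * s\<^sup>2\<close> converges while \<open>m\<close> tends to
    infinity, \<open>s\<close> itself must vanish.\<close>
  have "(\<lambda>k. real (mk k) * (s k)\<^sup>2 * (1 / real (mk k))) \<longlonglongrightarrow> t\<^sup>2 / 2 * 0"
    by (intro tendsto_mult ms div_m)
  moreover have "\<forall>\<^sub>F k in sequentially. real (mk k) * (s k)\<^sup>2 * (1 / real (mk k)) = (s k)\<^sup>2"
    using pos by eventually_elim simp
  ultimately have s2: "(\<lambda>k. (s k)\<^sup>2) \<longlonglongrightarrow> 0"
    using Lim_transform_eventually by force
  then have "(\<lambda>k. sqrt ((s k)\<^sup>2)) \<longlonglongrightarrow> sqrt 0" by (rule tendsto_real_sqrt)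
  then have sabs: "(\<lambda>k. \<bar>s k\<bar>) \<longlonglongrightarrow> 0" by simp
  then have s0: "s \<longlonglongrightarrow> 0" by (rule tendsto_rabs_zero_cancel)
  have "(\<lambda>k. variance_error (nk k)) \<longlonglongrightarrow> 0 + 0 + 0"
    unfolding variance_error_def by (intro tendsto_add div_n div_sqrt)
  then have "(\<lambda>k. char_error (nk k) (s k)) \<longlonglongrightarrow> (6 * 0 + 8 * 0 + 24 * 0) / 6 + 0 / 2 + 0"
    unfolding char_error_def
    by (intro tendsto_intros truncation_tail_tendsto_0[OF n_lim s0] sabs div_n s2) simp_all
  then have err1: "(\<lambda>k. real (mk k) * (s k)\<^sup>2 * char_error (nk k) (s k)) \<longlonglongrightarrow> 0"
    using tendsto_mult[OF ms] by fastforce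
  \<comment> \<open>The cost of the fluctuation of \<open>q\<close> is of order
    \<open>m * \<bar>s\<bar> / sqrt n\<close>, which factors into the bounded
    \<open>sqrt (m * s\<^sup>2)\<close> and the vanishing \<open>sqrt (m / n)\<close>.\<close>
  have "(\<lambda>k. sqrt (real (mk k) * (s k)\<^sup>2) * sqrt (real (mk k) / real (nk k)) * ((1 + \<sigma>\<^sup>2) / 2))
      \<longlonglongrightarrow> sqrt (t\<^sup>2 / 2) * sqrt 0 * ((1 + \<sigma>\<^sup>2) / 2)"
    by (intro tendsto_intros ms ratio_lim)
  moreover have "sqrt (real (mk k) * (s k)\<^sup>2) * sqrt (real (mk k) / real (nk k)) * ((1 + \<sigma>\<^sup>2) / 2)
      = real (mk k) * \<bar>s k\<bar> * ((1 + \<sigma>\<^sup>2) / (2 * sqrt (real (nk k))))" for k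
  proof -
    have "sqrt (real (mk k)) * \<bar>s k\<bar> * (sqrt (real (mk k)) / sqrt (real (nk k))) * ((1 + \<sigma>\<^sup>2) / 2)
      = sqrt (real (mk k)) * sqrt (real (mk k)) * \<bar>s k\<bar> * ((1 + \<sigma>\<^sup>2) / (2 * sqrt (real (nk k))))"
      by (simp only: divide_inverse inverse_mult_distrib mult_ac)
    then show ?thesis by (simp add: real_sqrt_mult real_sqrt_divide)
  qed
  ultimately have err2: "(\<lambda>k. real (mk k) * \<bar>s k\<bar> * ((1 + \<sigma>\<^sup>2) / (2 * sqrt (real (nk k))))) \<longlonglongrightarrow> 0"
    by (simp only: real_sqrt_zero mult_zero_right mult_zero_left)
  have char: "char (distr M borel (A k)) t = expectation (\<lambda>\<omega>. iexp (s k * ((\<Sum>i<mk k. excess (nk k) i \<omega>)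
        + real (mk k) * (mean_square (nk k) (\<lambda>j. x j \<omega>) - 1))))" if "nk k > 0" for k
  proof -
    have "t * A k \<omega> = s k * ((\<Sum>i<mk k. excess (nk k) i \<omega>) + real (mk k) * (mean_square (nk k) (\<lambda>j. x j \<omega>) - 1))" for \<omega>
    proof -
      define q where "q = mean_square (nk k) (\<lambda>j. x j \<omega>)"
      define X where "X = (\<Sum>i<mk k. excess (nk k) i \<omega>) + real (mk k) * (q - 1)"
      \<comment> \<open>Summing over the rows subtracts \<open>m * n * q\<close> from the squared
        norm; the term \<open>m * (q - 1)\<close> in \<open>X\<close>, times \<open>n\<close>, turns
        this into \<open>m * n\<close>.\<close>
      have "real (nk k) * (\<Sum>i<mk k. excess (nk k) i \<omega>)
          = (\<Sum>i<mk k. (\<Sum>j<nk k. S i j \<omega> * x j \<omega>)\<^sup>2 - real (nk k) * q)"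
        unfolding sum_distrib_left using that by (simp add: row_excess_def q_def right_diff_distrib)
      then have "sq_norm_SX (mk k) (nk k) (\<lambda>i j. S i j \<omega>) (\<lambda>j. x j \<omega>) - real (mk k) * real (nk k) = real (nk k) * X"
        by (simp add: X_def sq_norm_SX_def sum_subtractf algebra_simps)
      then have "t * A k \<omega> = s k * X" by (simp add: A_def s_def)
      then show ?thesis by (simp add: X_def q_def)
    qed
    moreover have "char (distr M borel (A k)) t = expectation (\<lambda>\<omega>. iexp (t * A k \<omega>))"
      unfolding char_def by (rule integral_distr) simp_all
    ultimately show ?thesis by (simp only:)
  qed
  have "(\<lambda>k. char (distr M borel (A k)) t - exp (- ((s k)\<^sup>2)) ^ mk k) \<longlonglongrightarrow> 0"
  proof (rule Lim_null_comparison)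
    show "\<forall>\<^sub>F k in sequentially. cmod (char (distr M borel (A k)) t - exp (- ((s k)\<^sup>2)) ^ mk k)
        \<le> real (mk k) * (s k)\<^sup>2 * char_error (nk k) (s k)
          + real (mk k) * \<bar>s k\<bar> * ((1 + \<sigma>\<^sup>2) / (2 * sqrt (real (nk k))))"
      using pos by eventually_elim (simp only: char sketch_char_approx)
    show "(\<lambda>k. real (mk k) * (s k)\<^sup>2 * char_error (nk k) (s k)
          + real (mk k) * \<bar>s k\<bar> * ((1 + \<sigma>\<^sup>2) / (2 * sqrt (real (nk k))))) \<longlonglongrightarrow> 0"
      using tendsto_add[OF err1 err2] by simp
  qed
  \<comment> \<open>The power equals the exponential of \<open>- (m * s\<^sup>2)\<close>, and
    \<open>m * s\<^sup>2\<close> tends to \<open>t\<^sup>2 / 2\<close>, which yields the Gaussian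
    characteristic function.\<close>
  moreover have "(\<lambda>k. complex_of_real (exp (- ((s k)\<^sup>2)) ^ mk k)) \<longlonglongrightarrow> complex_of_real (exp (- (t\<^sup>2 / 2)))"
  proof -
    have "exp (- ((s k)\<^sup>2)) ^ mk k = exp (- (real (mk k) * (s k)\<^sup>2))" for k
      by (simp flip: exp_of_nat_mult)
    then show ?thesis by (simp only:) (intro tendsto_intros ms)
  qed
  ultimately have "(\<lambda>k. (char (distr M borel (A k)) t - exp (- ((s k)\<^sup>2)) ^ mk k) + complex_of_real (exp (- ((s k)\<^sup>2)) ^ mk k))
      \<longlonglongrightarrow> 0 + complex_of_real (exp (- (t\<^sup>2 / 2)))"
    by (rule tendsto_add)
  then show "(\<lambda>k. char (distr M borel (A k)) t) \<longlonglongrightarrow> char std_normal_distribution t"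
    by (simp add: char_std_normal_distribution)
qed

end

theorem theorem2:
  fixes M :: "'a measure"
    and x :: "nat \<Rightarrow> 'a \<Rightarrow> real"
    and S :: "nat \<Rightarrow> nat \<Rightarrow> 'a \<Rightarrow> real"
    and \<sigma> c \<xi> :: real
    and mk nk :: "nat \<Rightarrow> nat"
  assumes M: "prob_space M"
    and x_meas: "\<And>j. x j \<in> borel_measurable M"
    and S_meas: "\<And>i j. S i j \<in> borel_measurable M"
    and indep: "prob_space.indep_vars M (\<lambda>_. borel)
                  (\<lambda>k. case k of Inl j \<Rightarrow> x j | Inr (i, j) \<Rightarrow> S i j) UNIV"
    and x_ident: "\<And>j. distr M borel (x j) = distr M borel (x 0)"
    and S_ident: "\<And>i j. distr M borel (S i j) = distr M borel (S 0 0)"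
    and x_int4: "integrable M (\<lambda>\<omega>. (x 0 \<omega>) ^ 4)"
    and x_mean: "(\<integral>\<omega>. x 0 \<omega> \<partial>M) = 0"
    and x_var: "(\<integral>\<omega>. (x 0 \<omega>)\<^sup>2 \<partial>M) = 1"
    and x_4th: "(\<integral>\<omega>. (x 0 \<omega>) ^ 4 \<partial>M) = 1 + \<sigma>\<^sup>2"
    and \<sigma>_nonneg: "0 \<le> \<sigma>"
    and S_int4: "integrable M (\<lambda>\<omega>. (S 0 0 \<omega>) ^ 4)"
    and S_mean: "(\<integral>\<omega>. S 0 0 \<omega> \<partial>M) = 0"
    and S_var: "(\<integral>\<omega>. (S 0 0 \<omega>)\<^sup>2 \<partial>M) = 1"
    and S_4th: "(\<integral>\<omega>. (S 0 0 \<omega>) ^ 4 \<partial>M) < c"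
    and \<xi>_def: "\<xi> = ((\<integral>\<omega>. (S 0 0 \<omega>) ^ 4 \<partial>M) - 1) * (\<integral>\<omega>. (x 0 \<omega>) ^ 4 \<partial>M) - 2"
    and m_lim: "filterlim mk at_top sequentially"
    and n_lim: "filterlim nk at_top sequentially"
    and ratio_lim: "(\<lambda>k. real (mk k) / real (nk k)) \<longlonglongrightarrow> 0"
  shows "weak_conv_m
           (\<lambda>k. distr M borel
              (\<lambda>\<omega>. (sq_norm_SX (mk k) (nk k) (\<lambda>i j. S i j \<omega>) (\<lambda>j. x j \<omega>)
                      - real (mk k) * real (nk k))
                    / sqrt (\<sigma>\<^sup>2 * (real (mk k))\<^sup>2 * real (nk k)
                            + 2 * real (mk k) * (real (nk k))\<^sup>2
                            + \<xi> * real (mk k) * real (nk k))))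
           std_normal_distribution"
proof -
  interpret iid_sketch M x S \<sigma>
    by (intro iid_sketch.intro iid_sketch_axioms.intro M x_meas S_meas indep x_ident S_ident
        x_int4 x_mean x_var x_4th S_int4 S_mean S_var)
  show ?thesis by (rule sketch_central_limit[OF m_lim n_lim ratio_lim])
qed

end
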